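(* Let $G$ be a locally profinite group with center $Z$ and let $R$ be an algebraically closed field such that $G$ has an open compact subgroup of invertible pro-order in $R$. Let $N$ be a closed subgroup of $G$ exhausted by compact subgroups of invertible pro-order in $R$, and let $\theta : N \to R^\times$ be a smooth character. Let $\pi$ be an irreducible $Z$-compact smooth $R$-representation of $G$, with contragredient $\pi^\vee$. Then $d_{\theta^{-1}}(\pi^\vee)$ is finite if and only if $d_\theta(\pi)$ is finite, in which case $$d_{\theta^{-1}}(\pi^\vee) = d_\theta(\pi).$$
   Context: A profinite group $K$ has invertible pro-order in $R$ if the index $[K:U]$ is invertible in $R$ for every open subgroup $U$ of $K$. The group $N$ is exhausted by compact subgroups of invertible pro-order in $R$ if every compact subset of $N$ is contained in a compact open subgroup of $N$ of invertible pro-order in $R$. An $R$-representation is smooth if each vector has open stabilizer; $\pi^\vee$ denotes the space of smooth linear forms on $\pi$. An irreducible smooth representation $\pi$ is $Z$-compact if all its matrix coefficients $g\mapsto v^\vee(\pi(g)v)$ ($v\in\pi$, $v^\vee\in\pi^\vee$) have compact support modulo $Z$. For a smooth representation $\pi$ of $G$ and a smooth character $\theta$ of $N$, set $d_\theta(\pi)=\dim_R \mathrm{Hom}_N(\pi,\theta)$. (Irreducible $Z$-compact representations are admissible, and the contragredient of one is again irreducible and $Z$-compact.) *)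

theory Defs
  imports
    "HOL-Analysis.T1_Spaces"
    "HOL-Algebra.Coset"
    "HOL-Computational_Algebra.Polynomial"
    "HOL-Library.Function_Algebras"
    "HOL-Library.Extended_Nat"
begin

section \<open>Locally profinite groups\<close>

locale topological_group = group G for G (structure) +
  fixes T :: "'g topology"
  assumes topspace_eq: "topspace T = carrier G"
    and continuous_mult: "continuous_map (prod_topology T T) T (\<lambda>(x, y). x \<otimes> y)"
    and continuous_inv: "continuous_map T T (\<lambda>x. inv x)"

locale locally_profinite_group = topological_group +
  assumes Hausdorff: "Hausdorff_space T"
    and compact_open_basis:
      "\<And>U. \<lbrakk>openin T U; \<one> \<in> U\<rbrakk> \<Longrightarrow> \<exists>K\<subseteq>U. subgroup K G \<and> openin T K \<and> compactin T K"

definition group_center :: "('g, 'm) monoid_scheme \<Rightarrow> 'g set" where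
  "group_center G = {z \<in> carrier G. \<forall>g\<in>carrier G. z \<otimes>\<^bsub>G\<^esub> g = g \<otimes>\<^bsub>G\<^esub> z}"

text \<open>
  A subgroup \<open>H\<close> of \<open>(G, T)\<close> is regarded as the topological group consisting of
  \<open>G\<lparr>carrier := H\<rparr>\<close> and \<open>subtopology T H\<close>. The coefficient field \<open>R\<close> is a type, and enters
  the next three definitions through a \<open>'r itself\<close> argument.
\<close>

definition invertible_pro_order ::
  "'r::field itself \<Rightarrow> ('g, 'm) monoid_scheme \<Rightarrow> 'g topology \<Rightarrow> bool" where
  "invertible_pro_order _ K T \<longleftrightarrow>
     (\<forall>U. subgroup U K \<and> openin T U \<longrightarrow> (of_nat (card (rcosets\<^bsub>K\<^esub> U)) :: 'r) dvd 1)"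

definition compact_open_subgroup_invertible_pro_order ::
  "'r::field itself \<Rightarrow> ('g, 'm) monoid_scheme \<Rightarrow> 'g topology \<Rightarrow> 'g set \<Rightarrow> bool" where
  "compact_open_subgroup_invertible_pro_order R G T K \<longleftrightarrow>
     subgroup K G \<and> openin T K \<and> compactin T K \<and>
     invertible_pro_order R (G\<lparr>carrier := K\<rparr>) (subtopology T K)"

definition exhausted_by_invertible_pro_order ::
  "'r::field itself \<Rightarrow> ('g, 'm) monoid_scheme \<Rightarrow> 'g topology \<Rightarrow> bool" where
  "exhausted_by_invertible_pro_order R N T \<longleftrightarrow>
     (\<forall>C. compactin T C \<longrightarrow>
        (\<exists>K. C \<subseteq> K \<and> compact_open_subgroup_invertible_pro_order R N T K))"

definition smooth_character ::
  "('g, 'm) monoid_scheme \<Rightarrow> 'g topology \<Rightarrow> ('g \<Rightarrow> 'r::field) \<Rightarrow> bool" where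
  "smooth_character N T \<theta> \<longleftrightarrow>
     (\<forall>x\<in>carrier N. \<theta> x \<noteq> 0) \<and>
     (\<forall>x\<in>carrier N. \<forall>y\<in>carrier N. \<theta> (x \<otimes>\<^bsub>N\<^esub> y) = \<theta> x * \<theta> y) \<and>
     openin T {x \<in> carrier N. \<theta> x = 1}"

section \<open>Smooth representations\<close>

text \<open>
  The space of a representation is a subspace \<open>V\<close> of an ambient vector space whose
  underlying set is a whole type; thus a representation and its contragredient, which is
  carried by a subspace of the functions on \<open>V\<close>, are objects of the same kind. Only the
  restriction of \<open>\<pi> g\<close> to \<open>V\<close>, for \<open>g\<close> in \<open>carrier G\<close>, is relevant.
\<close>

locale representation = group G + vs: vector_space scl
  for G (structure) and scl :: "'r::field \<Rightarrow> 'v::ab_group_add \<Rightarrow> 'v" +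
  fixes V :: "'v set" and \<pi> :: "'g \<Rightarrow> 'v \<Rightarrow> 'v"
  assumes subspace_V: "vs.subspace V"
    and action_closed: "\<And>g v. \<lbrakk>g \<in> carrier G; v \<in> V\<rbrakk> \<Longrightarrow> \<pi> g v \<in> V"
    and action_add:
      "\<And>g v w. \<lbrakk>g \<in> carrier G; v \<in> V; w \<in> V\<rbrakk> \<Longrightarrow> \<pi> g (v + w) = \<pi> g v + \<pi> g w"
    and action_scale:
      "\<And>g c v. \<lbrakk>g \<in> carrier G; v \<in> V\<rbrakk> \<Longrightarrow> \<pi> g (scl c v) = scl c (\<pi> g v)"
    and action_one: "\<And>v. v \<in> V \<Longrightarrow> \<pi> \<one> v = v"
    and action_mult:
      "\<And>g h v. \<lbrakk>g \<in> carrier G; h \<in> carrier G; v \<in> V\<rbrakk> \<Longrightarrow> \<pi> (g \<otimes> h) v = \<pi> g (\<pi> h v)"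

locale smooth_representation = topological_group G T + representation G scl V \<pi>
  for G (structure) and T :: "'g topology"
    and scl :: "'r::field \<Rightarrow> 'v::ab_group_add \<Rightarrow> 'v"
    and V :: "'v set" and \<pi> :: "'g \<Rightarrow> 'v \<Rightarrow> 'v" +
  assumes open_stabilizer: "\<And>v. v \<in> V \<Longrightarrow> openin T {g \<in> carrier G. \<pi> g v = v}"

locale irreducible_smooth_representation = smooth_representation +
  assumes nonzero: "V \<noteq> {0}"
    and irreducible:
      "\<And>W. \<lbrakk>vs.subspace W; W \<subseteq> V; \<And>g w. \<lbrakk>g \<in> carrier G; w \<in> W\<rbrakk> \<Longrightarrow> \<pi> g w \<in> W\<rbrakk>
        \<Longrightarrow> W = {0} \<or> W = V"

section \<open>Linear forms and the contragredient\<close>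

definition fun_scale :: "'r::field \<Rightarrow> ('v \<Rightarrow> 'r) \<Rightarrow> 'v \<Rightarrow> 'r" where
  "fun_scale c f = (\<lambda>v. c * f v)"

lemma vector_space_fun_scale: "vector_space (fun_scale :: 'r::field \<Rightarrow> ('v \<Rightarrow> 'r) \<Rightarrow> 'v \<Rightarrow> 'r)"
  by unfold_locales (auto simp: fun_scale_def algebra_simps)

text \<open>
  A linear form on \<open>V\<close> is represented by its extension by zero to the ambient type, so that
  equality of functions is equality of forms on \<open>V\<close>.
\<close>

definition linear_forms ::
  "('r::field \<Rightarrow> 'v::ab_group_add \<Rightarrow> 'v) \<Rightarrow> 'v set \<Rightarrow> ('v \<Rightarrow> 'r) set" where
  "linear_forms scl V =
     {f. (\<forall>v\<in>V. \<forall>w\<in>V. f (v + w) = f v + f w) \<and>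
         (\<forall>c. \<forall>v\<in>V. f (scl c v) = c * f v) \<and>
         (\<forall>v. v \<notin> V \<longrightarrow> f v = 0)}"

definition contragredient_action ::
  "('g, 'm) monoid_scheme \<Rightarrow> 'v set \<Rightarrow> ('g \<Rightarrow> 'v \<Rightarrow> 'v) \<Rightarrow> 'g \<Rightarrow> ('v \<Rightarrow> 'r::field) \<Rightarrow> 'v \<Rightarrow> 'r"
  where
  "contragredient_action G V \<pi> g f = (\<lambda>v. if v \<in> V then f (\<pi> (inv\<^bsub>G\<^esub> g) v) else 0)"

definition smooth_dual ::
  "('g, 'm) monoid_scheme \<Rightarrow> 'g topology \<Rightarrow> ('r::field \<Rightarrow> 'v::ab_group_add \<Rightarrow> 'v) \<Rightarrow> 'v set
    \<Rightarrow> ('g \<Rightarrow> 'v \<Rightarrow> 'v) \<Rightarrow> ('v \<Rightarrow> 'r) set" where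
  "smooth_dual G T scl V \<pi> =
     {f \<in> linear_forms scl V. openin T {g \<in> carrier G. contragredient_action G V \<pi> g f = f}}"

text \<open>
  A subset of \<open>G\<close> is compact modulo the center \<open>Z\<close> in the sense of support conditions if it
  is contained in \<open>C Z\<close> for some compact \<open>C\<close>.
\<close>

definition Z_compact ::
  "('g, 'm) monoid_scheme \<Rightarrow> 'g topology \<Rightarrow> ('r::field \<Rightarrow> 'v::ab_group_add \<Rightarrow> 'v) \<Rightarrow> 'v set
    \<Rightarrow> ('g \<Rightarrow> 'v \<Rightarrow> 'v) \<Rightarrow> bool" where
  "Z_compact G T scl V \<pi> \<longleftrightarrow>
     (\<forall>v\<in>V. \<forall>f\<in>smooth_dual G T scl V \<pi>.
        \<exists>C. compactin T C \<and> {g \<in> carrier G. f (\<pi> g v) \<noteq> 0} \<subseteq> C <#>\<^bsub>G\<^esub> group_center G)"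

definition Hom_character ::
  "('r::field \<Rightarrow> 'v::ab_group_add \<Rightarrow> 'v) \<Rightarrow> 'v set \<Rightarrow> ('g \<Rightarrow> 'v \<Rightarrow> 'v) \<Rightarrow> 'g set \<Rightarrow> ('g \<Rightarrow> 'r)
    \<Rightarrow> ('v \<Rightarrow> 'r) set" where
  "Hom_character scl V \<pi> N \<theta> =
     {f \<in> linear_forms scl V. \<forall>n\<in>N. \<forall>v\<in>V. f (\<pi> n v) = \<theta> n * f v}"

text \<open>
  The dimension of the space of \<open>N\<close>-homomorphisms from \<open>\<pi>\<close> to \<open>\<theta>\<close>. Infinite dimensions
  are not distinguished from each other; the constant \<open>vector_space.dim\<close> alone would
  give \<open>0\<close> in the infinite-dimensional case.
\<close>

definition d_character ::
  "('r::field \<Rightarrow> 'v::ab_group_add \<Rightarrow> 'v) \<Rightarrow> 'v set \<Rightarrow> ('g \<Rightarrow> 'v \<Rightarrow> 'v) \<Rightarrow> 'g set \<Rightarrow> ('g \<Rightarrow> 'r) \<Rightarrow> enat"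
  where
  "d_character scl V \<pi> N \<theta> =
     (let H = Hom_character scl V \<pi> N \<theta> in
      if \<exists>B. finite B \<and> H \<subseteq> module.span fun_scale B
      then enat (vector_space.dim fun_scale H) else \<infinity>)"

end

theory Submission
  imports Defs
begin

text \<open>
  Write \<open>W\<close> for the smooth dual of \<open>V\<close>, \<open>K\<close> for the span of all \<open>\<pi>(n) v - \<theta>(n) v\<close> with
  \<open>n \<in> N\<close> and \<open>v \<in> V\<close>, and \<open>K'\<close> for the analogous subspace of \<open>W\<close>, formed with \<open>\<theta>\<^sup>-\<^sup>1\<close>. The
  homomorphisms from \<open>\<pi>\<close> to \<open>\<theta>\<close> are the linear forms on the coinvariants \<open>V / K\<close>, so the two
  multiplicities are the dimensions of the duals of \<open>V / K\<close> and \<open>W / K'\<close>. They are compared through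
  their finite lower bounds: \<open>r\<close> vectors of \<open>V\<close> independent modulo \<open>K\<close> have to produce \<open>r\<close> elements
  of \<open>W\<close> independent modulo \<open>K'\<close>, and conversely (\<open>le_d_character_iff\<close>).

  Let \<open>v\<^sub>1, \<dots>, v\<^sub>r\<close> be independent modulo \<open>K\<close> and let \<open>w\<^sub>0 \<noteq> 0\<close> be a smooth form. For a compact
  open subgroup \<open>M\<close> of \<open>N\<close> of invertible pro-order, the \<open>\<theta>\<close>-twisted average of \<open>v\<^sub>a\<close> over \<open>M\<close> is a
  vector \<open>x\<^sub>a\<close> on which \<open>M\<close> acts by \<open>\<theta>\<close> and which is congruent to \<open>v\<^sub>a\<close> modulo \<open>K\<close>. The vectors
  \<open>x\<^sub>a\<close> change with \<open>M\<close>, but they can be tested on a finite set that does not: the coefficients of the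
  \<open>v\<^sub>a\<close> against \<open>w\<^sub>0\<close> have compact support modulo the center \<open>Z\<close> and \<open>w\<^sub>0\<close> has an open stabilizer,
  so there is a finite \<open>Q \<subseteq> G\<close> such that \<open>\<langle>v\<^sub>a, g w\<^sub>0\<rangle> \<noteq> 0\<close> only if \<open>g w\<^sub>0 \<in> Z Q w\<^sub>0\<close>. For a
  combination \<open>x\<close> of the \<open>x\<^sub>a\<close> it follows that \<open>\<langle>x, g w\<^sub>0\<rangle> \<noteq> 0\<close> only if \<open>g w\<^sub>0 \<in> M Z Q w\<^sub>0\<close>, and
  by equivariance these values are determined by those on \<open>Z Q w\<^sub>0\<close>. If they vanish, irreducibility
  gives \<open>x = 0\<close>. Suppose now that \<open>Q w\<^sub>0\<close> has rank less than \<open>r\<close> modulo \<open>K'\<close>. The finitely many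
  relations expressing this involve finitely many elements of \<open>N\<close>; once \<open>M\<close> contains them, the
  relations become equalities after pairing with any vector on which \<open>M\<close> acts by \<open>\<theta>\<close>. Then fewer
  than \<open>r\<close> linear conditions make \<open>x\<close> orthogonal to \<open>Q w\<^sub>0\<close>, and a nontrivial solution contradicts the
  independence of the \<open>v\<^sub>a\<close>. The uniformity of \<open>Q\<close> in \<open>M\<close> takes the place of an integral over \<open>N\<close>.
  The argument is symmetric in \<open>V\<close> and \<open>W\<close> and is carried out for an invariant pairing
  (\<open>codim_twisted_kernel_transfer\<close>).

  The passage from \<open>Q w\<^sub>0\<close> to \<open>Z Q w\<^sub>0\<close> is immediate if \<open>Z\<close> acts by scalars. It is also harmless when
  \<open>r = 1\<close>, because then \<open>Q w\<^sub>0\<close> lies in the \<open>Z\<close>-stable space \<open>K'\<close>; thus \<open>V / K\<close> and \<open>W / K'\<close> vanish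
  simultaneously in all cases. If some \<open>z \<in> Z\<close> does not act by a scalar, then \<open>\<pi>(z) - a\<close> is an
  invertible endomorphism of the irreducible \<open>\<pi>\<close> for every scalar \<open>a\<close>. Its inverse preserves \<open>K\<close>, so
  \<open>z\<close> has no eigenvector in \<open>V / K\<close>, and over an algebraically closed field \<open>V / K\<close> is zero or
  infinite-dimensional. The same holds for \<open>W / K'\<close>.

  The existence of \<open>w\<^sub>0\<close> rests on the compact open subgroup of \<open>G\<close> of invertible pro-order
  (\<open>exists_smooth_form\<close>).
\<close>

section \<open>Independence modulo a subspace\<close>

text \<open>
  Gaussian elimination: an equation with a nonzero coefficient eliminates one unknown.
\<close>

lemma homogeneous_system_nontrivial_solution:
  fixes M :: "'a \<Rightarrow> 's \<Rightarrow> 'r::field"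
  assumes "finite S" "finite A" "card S < card A"
  shows "\<exists>c. (\<exists>a\<in>A. c a \<noteq> 0) \<and> (\<forall>s\<in>S. (\<Sum>a\<in>A. c a * M a s) = 0)"
  using assms
proof (induction S arbitrary: A M rule: finite_induct)
  case empty
  then obtain a where "a \<in> A" by fastforce
  then show ?case by (intro exI[of _ "\<lambda>_. 1"]) auto
next
  case (insert s S)
  show ?case
  proof (cases "\<forall>a\<in>A. M a s = 0")
    case True
    have "card S < card A" using insert by simp
    from insert.IH[OF insert.prems(1) this, of M] True show ?thesis by auto
  next
    case False
    then obtain a0 where a0: "a0 \<in> A" "M a0 s \<noteq> 0" by blast
    \<comment> \<open>The equation \<open>s\<close> is solved for the unknown \<open>a0\<close> and substituted into the others.\<close>
    define A' where "A' = A - {a0}"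
    have A': "finite A'" "A = insert a0 A'" "a0 \<notin> A'" "card S < card A'"
      using insert a0 by (auto simp: A'_def)
    from insert.IH[OF A'(1,4), of "\<lambda>a t. M a t - M a s / M a0 s * M a0 t"]
    obtain c where c: "\<exists>a\<in>A'. c a \<noteq> 0"
      "\<And>t. t \<in> S \<Longrightarrow> (\<Sum>a\<in>A'. c a * (M a t - M a s / M a0 s * M a0 t)) = 0" by blast
    define k where "k = - (\<Sum>a\<in>A'. c a * M a s) / M a0 s"
    define c' where "c' = c(a0 := k)"
    have sum: "(\<Sum>a\<in>A. c' a * M a t) = k * M a0 t + (\<Sum>a\<in>A'. c a * M a t)" for t
    proof -
      have "(\<Sum>a\<in>A'. c' a * M a t) = (\<Sum>a\<in>A'. c a * M a t)"
        using A'(3) by (intro sum.cong) (auto simp: c'_def)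
      then show ?thesis using A' by (simp add: c'_def)
    qed
    have "(\<Sum>a\<in>A. c' a * M a t) = 0" if "t \<in> insert s S" for t
    proof (cases "t = s")
      case True
      then show ?thesis unfolding sum using a0 by (simp add: k_def)
    next
      case False
      then have "(\<Sum>a\<in>A'. c a * M a t) - (\<Sum>a\<in>A'. c a * M a s) / M a0 s * M a0 t = 0"
        using c(2)[of t] that
        by (simp add: right_diff_distrib sum_subtractf sum_divide_distrib sum_distrib_right mult.assoc)
      then show ?thesis unfolding sum by (simp add: k_def)
    qed
    moreover have "\<exists>a\<in>A. c' a \<noteq> 0" using c(1) A' by (auto simp: c'_def)
    ultimately show ?thesis by blast
  qed
qed

text \<open>
  The family \<open>p\<close> becomes linearly independent in the quotient by \<open>K\<close>. Working with representatives
  avoids the construction of quotient spaces.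
\<close>

definition indep_mod ::
  "('r::field \<Rightarrow> 'b::ab_group_add \<Rightarrow> 'b) \<Rightarrow> 'b set \<Rightarrow> 'i set \<Rightarrow> ('i \<Rightarrow> 'b) \<Rightarrow> bool" where
  "indep_mod scl K I p \<longleftrightarrow> (\<forall>c. (\<Sum>i\<in>I. scl (c i) (p i)) \<in> K \<longrightarrow> (\<forall>i\<in>I. c i = 0))"

text \<open>
  For a subspace \<open>K\<close> of \<open>V\<close> this says that \<open>dim (V / K) \<ge> r\<close>. A lower bound makes sense for finite and
  for infinite codimension alike.
\<close>

definition codim_at_least ::
  "('r::field \<Rightarrow> 'b::ab_group_add \<Rightarrow> 'b) \<Rightarrow> 'b set \<Rightarrow> 'b set \<Rightarrow> nat \<Rightarrow> bool" where
  "codim_at_least scl V K r \<longleftrightarrow>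
     (\<exists>p::nat \<Rightarrow> 'b. (\<forall>i<r. p i \<in> V) \<and> indep_mod scl K {..<r} p)"

context vector_space
begin

lemma codim_at_leastI:
  assumes I: "finite I" "r \<le> card I" and p: "\<And>i. i \<in> I \<Longrightarrow> p i \<in> V" and ind: "indep_mod scale K I p"
  shows "codim_at_least scale V K r"
proof -
  obtain J where J: "J \<subseteq> I" "card J = r" "finite J"
    using I by (meson obtain_subset_with_card_n)
  then obtain h where h: "bij_betw h {..<r} J"
    by (metis card_lessThan finite_lessThan finite_same_card_bij)
  have "indep_mod scale K {..<r} (p \<circ> h)"
    unfolding indep_mod_def
  proof (intro allI impI ballI)
    fix c i assume c: "(\<Sum>i\<in>{..<r}. c i *s (p \<circ> h) i) \<in> K" and i: "i \<in> {..<r}"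
    define c' where "c' = (\<lambda>j. if j \<in> J then c (inv_into {..<r} h j) else 0)"
    have "(\<Sum>j\<in>I. c' j *s p j) = (\<Sum>j\<in>J. c' j *s p j)"
      using J I by (intro sum.mono_neutral_right) (auto simp: c'_def)
    also have "\<dots> = (\<Sum>i\<in>{..<r}. c' (h i) *s p (h i))"
      by (rule sum.reindex_bij_betw[OF h, symmetric])
    also have "\<dots> = (\<Sum>i\<in>{..<r}. c i *s (p \<circ> h) i)"
      using h by (intro sum.cong refl) (auto simp: c'_def bij_betw_def)
    finally have "(\<Sum>j\<in>I. c' j *s p j) \<in> K" using c by simp
    with ind have "\<forall>j\<in>I. c' j = 0" unfolding indep_mod_def by blast
    then have "c' (h i) = 0" using h i J by (auto simp: bij_betw_def)
    then show "c i = 0" using h i by (auto simp: c'_def bij_betw_def)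
  qed
  moreover have "\<forall>i<r. (p \<circ> h) i \<in> V" using h J p by (auto simp: bij_betw_def)
  ultimately show ?thesis unfolding codim_at_least_def by blast
qed

lemma codim_at_least_one_iff:
  assumes "subspace K"
  shows "codim_at_least scale V K 1 \<longleftrightarrow> \<not> V \<subseteq> K"
proof
  assume "codim_at_least scale V K 1"
  then obtain p where p: "p (0::nat) \<in> V" "indep_mod scale K {..<1} p"
    unfolding codim_at_least_def by auto
  have "p 0 \<notin> K"
  proof
    assume "p 0 \<in> K"
    then have "(\<Sum>i\<in>{..<1::nat}. 1 *s p i) \<in> K" by simp
    with p(2) have "\<forall>i\<in>{..<1::nat}. (1::'a) = 0"
      unfolding indep_mod_def by (elim allE[of _ "\<lambda>_. 1"]) blast
    then show False by auto
  qed
  with p show "\<not> V \<subseteq> K" by blast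
next
  assume "\<not> V \<subseteq> K"
  then obtain v where v: "v \<in> V" "v \<notin> K" by blast
  have "indep_mod scale K {v} id"
    unfolding indep_mod_def
  proof (intro allI impI ballI)
    fix c i assume "(\<Sum>i\<in>{v}. c i *s id i) \<in> K" and "i \<in> {v}"
    then have "c v *s v \<in> K" by simp
    then have "c v \<noteq> 0 \<Longrightarrow> inverse (c v) *s (c v *s v) \<in> K"
      using assms subspace_scale by blast
    then show "c i = 0" using v \<open>i \<in> {v}\<close> by auto
  qed
  then show "codim_at_least scale V K 1" using v by (intro codim_at_leastI[of "{v}"]) auto
qed

lemma codim_at_least_mono:
  assumes r: "codim_at_least scale V K r" and s: "s \<le> r"
  shows "codim_at_least scale V K s"
proof -
  obtain p :: "nat \<Rightarrow> 'b" where p: "\<forall>i<r. p i \<in> V" "indep_mod scale K {..<r} p"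
    using r unfolding codim_at_least_def by blast
  show ?thesis
    by (rule codim_at_leastI[of "{..<r}" s p]) (use p s in simp_all)
qed

text \<open>
  The vectors indexed by a largest independent \<open>I\<close> form a basis of the span of the family modulo \<open>K\<close>;
  \<open>\<alpha> q\<close> are the coordinates of \<open>p q\<close> in this basis.
\<close>

lemma maximal_indep_mod:
  assumes K: "subspace K"
    and bound: "\<And>I. \<lbrakk>finite I; I \<subseteq> Q; indep_mod scale K I p\<rbrakk> \<Longrightarrow> card I \<le> n"
  shows "\<exists>I \<alpha>. finite I \<and> I \<subseteq> Q \<and> indep_mod scale K I p \<and>
    (\<forall>q\<in>Q. p q - (\<Sum>i\<in>I. \<alpha> q i *s p i) \<in> K)"
proof -
  let ?P = "\<lambda>I. finite I \<and> I \<subseteq> Q \<and> indep_mod scale K I p"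
  have "?P {}" by (auto simp: indep_mod_def)
  moreover have "\<forall>I. ?P I \<longrightarrow> card I < Suc n" using bound by (simp add: less_Suc_eq_le)
  ultimately obtain I where I: "?P I" and max: "\<And>J. ?P J \<Longrightarrow> card J \<le> card I"
    using ex_has_greatest_nat[of ?P "{}" card "Suc n"] by auto
  have "\<exists>\<beta>. p q - (\<Sum>i\<in>I. \<beta> i *s p i) \<in> K" if q: "q \<in> Q" for q
  proof (cases "q \<in> I")
    case True
    have "(\<Sum>i\<in>I. (if i = q then 1 else 0) *s p i) = (\<Sum>i\<in>I. if i = q then p i else 0)"
      by (intro sum.cong) auto
    also have "\<dots> = p q" using True I by (simp add: sum.delta)
    finally show ?thesis using subspace_0[OF K]
      by (intro exI[of _ "\<lambda>i. if i = q then 1 else 0"]) auto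
  next
    case False
    have "\<not> ?P (insert q I)" using max[of "insert q I"] False I by auto
    then obtain c where c: "(\<Sum>i\<in>insert q I. c i *s p i) \<in> K" "\<exists>i\<in>insert q I. c i \<noteq> 0"
      using I q unfolding indep_mod_def by blast
    have split: "(\<Sum>i\<in>insert q I. c i *s p i) = c q *s p q + (\<Sum>i\<in>I. c i *s p i)"
      using I False by simp
    have cq: "c q \<noteq> 0"
    proof
      assume "c q = 0"
      then have "(\<Sum>i\<in>I. c i *s p i) \<in> K" using c(1) split by simp
      then have "\<forall>i\<in>I. c i = 0" using I unfolding indep_mod_def by blast
      with \<open>c q = 0\<close> c(2) show False by auto
    qed
    have "inverse (c q) *s (c q *s p q + (\<Sum>i\<in>I. c i *s p i)) \<in> K"
      using c(1) split K subspace_scale by metis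
    also have "inverse (c q) *s (c q *s p q + (\<Sum>i\<in>I. c i *s p i))
        = p q - (\<Sum>i\<in>I. (- inverse (c q) * c i) *s p i)"
      using cq by (simp add: scale_right_distrib scale_sum_right sum_negf)
    finally show ?thesis by (intro exI[of _ "\<lambda>i. - inverse (c q) * c i"])
  qed
  then have "\<forall>q\<in>Q. \<exists>\<beta>. p q - (\<Sum>i\<in>I. \<beta> i *s p i) \<in> K" by blast
  then obtain \<alpha> where "\<forall>q\<in>Q. p q - (\<Sum>i\<in>I. \<alpha> q i *s p i) \<in> K"
    unfolding bchoice_iff by blast
  then show ?thesis using I by blast
qed

text \<open>
  A basis of \<open>L\<close> together with \<open>x\<close> is independent, so a linear map may be prescribed on it.
\<close>

lemma separating_form:
  assumes L: "subspace L" and x: "x \<notin> L"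
  obtains f where "Vector_Spaces.linear scale (*) f" "\<And>u. u \<in> L \<Longrightarrow> f u = 0" "f x = 1"
proof -
  interpret vp: vector_space_pair scale "(*) :: 'a \<Rightarrow> 'a \<Rightarrow> 'a"
    by unfold_locales (auto simp: algebra_simps)
  obtain B where B: "B \<subseteq> L" "independent B" "L \<subseteq> span B"
    by (rule maximal_independent_subset)
  have sp: "span B = L" using B L by (metis span_minimal subset_antisym)
  then have "x \<notin> span B" using x by simp
  then have ind: "independent (insert x B)" using B(2) by (rule independent_insertI)
  then obtain f where f: "Vector_Spaces.linear scale (*) f"
    "\<forall>y\<in>insert x B. f y = (if y = x then 1 else 0)"
    using vp.linear_independent_extend[OF ind, of "\<lambda>y. if y = x then 1 else 0"] by auto
  have fB: "f b = 0" if "b \<in> B" for b using f(2) that x B by auto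
  have "f u = 0" if "u \<in> L" for u
    using vp.linear_eq_0_on_span[OF f(1) fB] that sp by blast
  then show thesis using that f by auto
qed

end

interpretation fs: vector_space "fun_scale :: 'r::field \<Rightarrow> ('v \<Rightarrow> 'r) \<Rightarrow> 'v \<Rightarrow> 'r"
  by (rule vector_space_fun_scale)

lemma sum_fun_scale_apply: "(\<Sum>i\<in>I. fun_scale (c i) (f i)) x = (\<Sum>i\<in>I. c i * f i x)"
  by (induction I rule: infinite_finite_induct) (auto simp: fun_scale_def)

text \<open>
  Row rank equals column rank for the matrix \<open>(f b)\<close> whose rows are the functions in \<open>F\<close> and whose
  columns are all points: independent rows force at least \<open>card F\<close> independent columns.
\<close>

lemma independent_functions_separated_by_points:
  fixes F :: "('v \<Rightarrow> 'r::field) set"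
  assumes F: "finite F" "fs.independent F"
  obtains I where "finite I" "card F \<le> card I"
    "\<And>c. (\<forall>f\<in>F. (\<Sum>b\<in>I. c b * f b) = 0) \<Longrightarrow> \<forall>b\<in>I. c b = 0"
proof -
  define p :: "'v \<Rightarrow> ('v \<Rightarrow> 'r) \<Rightarrow> 'r" where "p b = (\<lambda>f. if f \<in> F then f b else 0)" for b
  have zero_iff: "(\<Sum>b\<in>I. fun_scale (c b) (p b)) \<in> {0} \<longleftrightarrow> (\<forall>f\<in>F. (\<Sum>b\<in>I. c b * f b) = 0)"
    for I c
  proof -
    have "(\<Sum>b\<in>I. fun_scale (c b) (p b)) f = (if f \<in> F then \<Sum>b\<in>I. c b * f b else 0)" for f
      by (simp add: sum_fun_scale_apply p_def)
    then show ?thesis by (auto simp: fun_eq_iff)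
  qed
  have bound: "card I \<le> card F" if I: "finite I" "I \<subseteq> UNIV" "indep_mod fun_scale {0} I p" for I
  proof (rule ccontr)
    assume "\<not> card I \<le> card F"
    then obtain c where "\<exists>b\<in>I. c b \<noteq> 0" "\<forall>f\<in>F. (\<Sum>b\<in>I. c b * f b) = 0"
      using homogeneous_system_nontrivial_solution[of F I "\<lambda>b f. f b"] F(1) I(1) by auto
    with I(3) show False unfolding indep_mod_def zero_iff by blast
  qed
  have "\<exists>I \<alpha>. finite I \<and> I \<subseteq> UNIV \<and> indep_mod fun_scale {0} I p \<and>
      (\<forall>q\<in>UNIV. p q - (\<Sum>i\<in>I. fun_scale (\<alpha> q i) (p i)) \<in> {0})"
    by (rule fs.maximal_indep_mod[OF fs.subspace_single_0]) (rule bound)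
  then obtain I \<alpha> where I: "finite I" "indep_mod fun_scale {0} I p"
    and rel: "\<forall>q\<in>UNIV. p q - (\<Sum>i\<in>I. fun_scale (\<alpha> q i) (p i)) \<in> {0}"
    by (elim exE conjE) (rule that)
  have span: "f q = (\<Sum>i\<in>I. \<alpha> q i * f i)" if "f \<in> F" for f q
  proof -
    have "p q - (\<Sum>i\<in>I. fun_scale (\<alpha> q i) (p i)) = 0" using rel by blast
    then have "p q = (\<Sum>i\<in>I. fun_scale (\<alpha> q i) (p i))" unfolding right_minus_eq .
    then have "p q f = (\<Sum>i\<in>I. fun_scale (\<alpha> q i) (p i)) f" by (rule fun_cong)
    then show ?thesis using that by (simp add: sum_fun_scale_apply p_def)
  qed
  have "card F \<le> card I"
  proof (rule ccontr)
    assume "\<not> card F \<le> card I"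
    then obtain d where d: "\<exists>f\<in>F. d f \<noteq> 0" "\<forall>i\<in>I. (\<Sum>f\<in>F. d f * f i) = 0"
      using homogeneous_system_nontrivial_solution[of I F "\<lambda>f b. f b"] F(1) I(1) by auto
    have "(\<Sum>f\<in>F. fun_scale (d f) f) q = 0" for q
    proof -
      have "(\<Sum>f\<in>F. d f * f q) = (\<Sum>f\<in>F. \<Sum>i\<in>I. \<alpha> q i * (d f * f i))"
        by (intro sum.cong refl, subst span) (simp_all add: sum_distrib_left mult_ac)
      also have "\<dots> = (\<Sum>i\<in>I. \<alpha> q i * (\<Sum>f\<in>F. d f * f i))"
        by (subst sum.swap) (simp add: sum_distrib_left)
      also have "\<dots> = 0" using d(2) by simp
      finally show ?thesis by (simp add: sum_fun_scale_apply)
    qed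
    then have "(\<Sum>f\<in>F. fun_scale (d f) f) = 0" by auto
    then have "fs.dependent F" using d(1) fs.dependent_finite[OF F(1)] by auto
    then show False using F(2) by contradiction
  qed
  moreover have "\<forall>b\<in>I. c b = 0" if "\<forall>f\<in>F. (\<Sum>b\<in>I. c b * f b) = 0" for c
    using I(2) that unfolding indep_mod_def zero_iff by blast
  ultimately show thesis using that I(1) by blast
qed

section \<open>Sums over cosets\<close>

text \<open>
  Used for functions \<open>F\<close> on \<open>M\<close> that are constant on right cosets of \<open>S\<close>, for which the choice of
  representatives is immaterial.
\<close>

definition coset_sum ::
  "('g, 'm) monoid_scheme \<Rightarrow> 'g set \<Rightarrow> 'g set \<Rightarrow> ('g \<Rightarrow> 'a::comm_monoid_add) \<Rightarrow> 'a" where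
  "coset_sum G M S F = (\<Sum>C\<in>rcosets\<^bsub>G\<lparr>carrier := M\<rparr>\<^esub> S. F (SOME a. a \<in> C))"

context group
begin

lemma rcosets_subgroup_eq_image: "rcosets\<^bsub>G\<lparr>carrier := M\<rparr>\<^esub> S = (\<lambda>a. S #> a) ` M"
  by (auto simp: RCOSETS_def)

lemma coset_representative:
  assumes S: "subgroup S G" and M: "subgroup M G" "S \<subseteq> M" and a: "a \<in> M"
  obtains s where "s \<in> S" "(SOME b. b \<in> S #> a) = s \<otimes> a"
proof -
  have "a \<in> S #> a" using rcos_self S M a subgroup.mem_carrier by metis
  then have "(SOME b. b \<in> S #> a) \<in> S #> a" by (rule someI)
  then show thesis using that by (auto simp: r_coset_def)
qed

text \<open>
  Right translation by an element of \<open>M\<close> permutes the right cosets of \<open>S\<close> in \<open>M\<close>.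
\<close>

lemma coset_sum_translate:
  assumes S: "subgroup S G" and M: "subgroup M G" "S \<subseteq> M"
    and F: "\<And>s a. \<lbrakk>s \<in> S; a \<in> M\<rbrakk> \<Longrightarrow> F (s \<otimes> a) = F a" and n: "n \<in> M"
  shows "coset_sum G M S (\<lambda>a. F (a \<otimes> n)) = coset_sum G M S F"
proof -
  let ?rep = "\<lambda>C. SOME a. a \<in> C"
  have mem: "x \<in> carrier G" if "x \<in> M" for x using subgroup.mem_carrier[OF M(1) that] .
  have Sc: "S \<subseteq> carrier G" using S subgroup.subset by blast
  have rep: "F (?rep (S #> a)) = F a" if a: "a \<in> M" for a
  proof -
    obtain s where "s \<in> S" "?rep (S #> a) = s \<otimes> a" using coset_representative[OF S M a] .
    then show ?thesis using F a by simp
  qed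
  have rep': "F (?rep (S #> a) \<otimes> n) = F (a \<otimes> n)" if a: "a \<in> M" for a
  proof -
    obtain s where s: "s \<in> S" "?rep (S #> a) = s \<otimes> a" using coset_representative[OF S M a] .
    then have "?rep (S #> a) \<otimes> n = s \<otimes> (a \<otimes> n)" using s a n mem Sc by (simp add: m_assoc subsetD)
    then show ?thesis using F[OF s(1), of "a \<otimes> n"] subgroup.m_closed[OF M(1) a n] by simp
  qed
  have shift: "(S #> a) #> b = S #> (a \<otimes> b)" if "a \<in> M" "b \<in> M" for a b
    using coset_mult_assoc[OF Sc] mem that by simp
  have ninv: "inv n \<in> M" using subgroup.m_inv_closed[OF M(1) n] .
  show ?thesis
    unfolding coset_sum_def rcosets_subgroup_eq_image
  proof (rule sum.reindex_bij_witness[where i = "\<lambda>C. C #> inv n" and j = "\<lambda>C. C #> n"])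
    fix C assume "C \<in> (\<lambda>a. S #> a) ` M"
    then obtain a where a: "a \<in> M" "C = S #> a" by blast
    show "C #> n #> inv n = C" "C #> inv n #> n = C"
      using a n ninv mem subgroup.m_closed[OF M(1)]
      by (simp_all add: shift m_assoc)
    show "C #> n \<in> (\<lambda>a. S #> a) ` M" "C #> inv n \<in> (\<lambda>a. S #> a) ` M"
      using a n ninv subgroup.m_closed[OF M(1)] by (auto simp: shift)
    show "F (?rep (C #> n)) = F (?rep C \<otimes> n)"
      using a n subgroup.m_closed[OF M(1)] by (simp add: shift rep rep')
  qed
qed

text \<open>
  A coset of \<open>S\<close> in \<open>K\<close> is uniquely \<open>C r\<close> with \<open>C\<close> a coset of \<open>S\<close> in \<open>U\<close> and \<open>r\<close> a chosen
  representative of a coset of \<open>U\<close> in \<open>K\<close>. Thus indices inside a subgroup of a group of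
  invertible pro-order are again invertible.
\<close>

lemma card_rcosets_trans:
  assumes S: "subgroup S G" and U: "subgroup U G" "S \<subseteq> U" and K: "subgroup K G" "U \<subseteq> K"
  shows "card (rcosets\<^bsub>G\<lparr>carrier := K\<rparr>\<^esub> S) =
    card (rcosets\<^bsub>G\<lparr>carrier := U\<rparr>\<^esub> S) * card (rcosets\<^bsub>G\<lparr>carrier := K\<rparr>\<^esub> U)"
proof -
  have mem: "x \<in> carrier G" if "x \<in> K" for x using subgroup.mem_carrier[OF K(1) that] .
  have memU: "x \<in> K" if "x \<in> U" for x using that K by blast
  have Sc: "S \<subseteq> carrier G" using S subgroup.subset by blast
  have Uc: "U \<subseteq> carrier G" using U subgroup.subset by blast
  let ?rep = "\<lambda>C. SOME a. a \<in> C"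
  let ?A = "(\<lambda>a. S #> a) ` U" and ?B = "(\<lambda>a. U #> a) ` K"
  have rep: "?rep D \<in> K \<and> U #> ?rep D = D" if D: "D \<in> ?B" for D
  proof -
    obtain a where a: "a \<in> K" "D = U #> a" using D by blast
    obtain u where u: "u \<in> U" "?rep D = u \<otimes> a" using coset_representative[OF U(1) K a(1)] a by metis
    have "?rep D \<in> U #> a" using u by (auto simp: r_coset_def)
    then have "U #> a = U #> ?rep D" using repr_independence a mem U(1) by blast
    then show ?thesis using u a K by (simp add: memU subgroup.m_closed)
  qed
  have shift: "(S #> u) #> a = S #> (u \<otimes> a)" if "u \<in> U" "a \<in> K" for u a
    using coset_mult_assoc[OF Sc] mem memU that by simp
  have "bij_betw (\<lambda>(C, D). C #> ?rep D) (?A \<times> ?B) ((\<lambda>a. S #> a) ` K)"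
    unfolding bij_betw_def
  proof
    show "inj_on (\<lambda>(C, D). C #> ?rep D) (?A \<times> ?B)"
    proof (rule inj_onI, clarify)
      fix u u' b b' assume u: "u \<in> U" "u' \<in> U" and b: "b \<in> K" "b' \<in> K"
      define d where "d = ?rep (U #> b)"
      define d' where "d' = ?rep (U #> b')"
      assume "S #> u #> ?rep (U #> b) = S #> u' #> ?rep (U #> b')"
      then have eq: "S #> u #> d = S #> u' #> d'" by (simp add: d_def d'_def)
      have d: "d \<in> K" "U #> d = U #> b" "d' \<in> K" "U #> d' = U #> b'"
        using rep b unfolding d_def d'_def by blast+
      note c = mem[OF d(1)] mem[OF d(3)] mem[OF memU[OF u(1)]] mem[OF memU[OF u(2)]]
      have "u \<otimes> d \<in> S #> (u \<otimes> d)" using rcos_self[OF _ S] c by simp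
      then have "u \<otimes> d \<in> S #> (u' \<otimes> d')" using eq shift u d by simp
      then obtain s where s: "s \<in> S" "u \<otimes> d = s \<otimes> (u' \<otimes> d')" by (auto simp: r_coset_def)
      have sU: "s \<in> U" and sc: "s \<in> carrier G" using s U Sc by auto
      have "d = inv u \<otimes> (u \<otimes> d)" using c by (simp add: m_assoc[symmetric])
      also have "\<dots> = (inv u \<otimes> (s \<otimes> u')) \<otimes> d'" using s c sc by (simp add: m_assoc)
      finally have "d \<in> U #> d'"
        using u sU U(1) by (auto simp: r_coset_def subgroup.m_closed subgroup.m_inv_closed)
      then have "U #> d' = U #> d" using repr_independence c U(1) by blast
      then have bb: "U #> b = U #> b'" using d by simp
      then have dd: "d = d'" by (simp add: d_def d'_def)
      have "S #> u = S #> u #> d #> inv d" using c Sc by (simp add: coset_mult_assoc m_assoc)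
      also have "\<dots> = S #> u' #> d' #> inv d'" using eq dd by simp
      also have "\<dots> = S #> u'" using c Sc by (simp add: coset_mult_assoc m_assoc)
      finally show "S #> u = S #> u' \<and> U #> b = U #> b'" using bb by simp
    qed
    show "(\<lambda>(C, D). C #> ?rep D) ` (?A \<times> ?B) = (\<lambda>a. S #> a) ` K"
    proof
      show "(\<lambda>(C, D). C #> ?rep D) ` (?A \<times> ?B) \<subseteq> (\<lambda>a. S #> a) ` K"
      proof clarify
        fix u b assume "u \<in> U" "b \<in> K"
        moreover have "?rep (U #> b) \<in> K" using rep \<open>b \<in> K\<close> by blast
        ultimately show "S #> u #> ?rep (U #> b) \<in> (\<lambda>a. S #> a) ` K"
          by (simp add: shift memU subgroup.m_closed[OF K(1)])
      qed
      show "(\<lambda>a. S #> a) ` K \<subseteq> (\<lambda>(C, D). C #> ?rep D) ` (?A \<times> ?B)"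
      proof
        fix C assume "C \<in> (\<lambda>a. S #> a) ` K"
        then obtain a where a: "a \<in> K" "C = S #> a" by blast
        define d where "d = ?rep (U #> a)"
        have d: "d \<in> K" "U #> d = U #> a" using rep a unfolding d_def by blast+
        have "a \<in> U #> d" using d rcos_self[OF _ U(1)] a mem by metis
        then obtain u where u: "u \<in> U" "a = u \<otimes> d" by (auto simp: r_coset_def)
        have "C = S #> u #> d" using a u d shift by simp
        then have "C = (\<lambda>(C, D). C #> ?rep D) (S #> u, U #> a)" by (simp add: d_def)
        then show "C \<in> (\<lambda>(C, D). C #> ?rep D) ` (?A \<times> ?B)" using u a by blast
      qed
    qed
  qed
  then show ?thesis
    unfolding rcosets_subgroup_eq_image by (metis bij_betw_same_card card_cartesian_product)
qed

lemma group_center_closed: "z \<in> group_center G \<Longrightarrow> z \<in> carrier G"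
  and group_center_commute: "\<lbrakk>z \<in> group_center G; g \<in> carrier G\<rbrakk> \<Longrightarrow> z \<otimes> g = g \<otimes> z"
  by (auto simp: group_center_def)

lemma group_center_inv:
  assumes z: "z \<in> group_center G"
  shows "inv z \<in> group_center G"
  unfolding group_center_def
proof (intro CollectI conjI ballI)
  show "inv z \<in> carrier G" using group_center_closed[OF z] by simp
  fix g assume g: "g \<in> carrier G"
  have "inv z \<otimes> g = inv z \<otimes> (g \<otimes> z) \<otimes> inv z"
    using g group_center_closed[OF z] by (simp add: m_assoc)
  also have "g \<otimes> z = z \<otimes> g" using group_center_commute[OF z g] by simp
  also have "inv z \<otimes> (z \<otimes> g) \<otimes> inv z = g \<otimes> inv z"
    using g group_center_closed[OF z] by (simp add: m_assoc[symmetric])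
  finally show "inv z \<otimes> g = g \<otimes> inv z" .
qed

end

section \<open>Open sets in topological groups\<close>

context topological_group
begin

lemma continuous_left_translation:
  assumes "g \<in> carrier G"
  shows "continuous_map T T (\<lambda>x. g \<otimes> x)"
proof -
  have "continuous_map T (prod_topology T T) (\<lambda>x. (g, x))"
    using assms by (auto simp: continuous_map_pairwise o_def topspace_eq)
  from continuous_map_compose[OF this continuous_mult] show ?thesis by (simp add: o_def)
qed

lemma continuous_right_translation:
  assumes "g \<in> carrier G"
  shows "continuous_map T T (\<lambda>x. x \<otimes> g)"
proof -
  have "continuous_map T (prod_topology T T) (\<lambda>x. (x, g))"
    using assms by (auto simp: continuous_map_pairwise o_def topspace_eq)
  from continuous_map_compose[OF this continuous_mult] show ?thesis by (simp add: o_def)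
qed

lemma openin_left_translate:
  assumes U: "openin T U" and g: "g \<in> carrier G"
  shows "openin T (g <# U)"
proof -
  have Uc: "U \<subseteq> carrier G" using openin_subset[OF U] topspace_eq by simp
  have "g <# U = {x \<in> topspace T. inv g \<otimes> x \<in> U}"
  proof (intro equalityI subsetI)
    fix x assume "x \<in> g <# U"
    then obtain u where "u \<in> U" "x = g \<otimes> u" by (auto simp: l_coset_def)
    then show "x \<in> {x \<in> topspace T. inv g \<otimes> x \<in> U}"
      using Uc g by (auto simp: topspace_eq m_assoc[symmetric])
  next
    fix x assume "x \<in> {x \<in> topspace T. inv g \<otimes> x \<in> U}"
    then have x: "x \<in> carrier G" "inv g \<otimes> x \<in> U" by (auto simp: topspace_eq)
    have "x = g \<otimes> (inv g \<otimes> x)" using x g by (simp add: m_assoc[symmetric])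
    then show "x \<in> g <# U" using x by (auto simp: l_coset_def)
  qed
  then show ?thesis
    using openin_continuous_map_preimage[OF continuous_left_translation U, of "inv g"] g by simp
qed

lemma openin_conjugate:
  assumes U: "openin T U" and g: "g \<in> carrier G"
  shows "openin T {x \<in> carrier G. inv g \<otimes> x \<otimes> g \<in> U}"
proof -
  have "continuous_map T T (\<lambda>x. inv g \<otimes> x \<otimes> g)"
    using continuous_map_compose[OF continuous_left_translation[of "inv g"]
        continuous_right_translation[of g]] g
    by (simp add: o_def)
  from openin_continuous_map_preimage[OF this U] show ?thesis by (simp add: topspace_eq)
qed

lemma openin_if_absorbs_open:
  assumes H: "H \<subseteq> carrier G" and U: "openin T U" "\<one> \<in> U"
    and absorb: "\<And>h u. \<lbrakk>h \<in> H; u \<in> U\<rbrakk> \<Longrightarrow> h \<otimes> u \<in> H"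
  shows "openin T H"
proof -
  have "H = (\<Union>h\<in>H. h <# U)"
  proof (intro equalityI subsetI)
    fix h assume h: "h \<in> H"
    then have "h = h \<otimes> \<one>" using H by auto
    then have "h \<in> h <# U" using U(2) unfolding l_coset_def by blast
    then show "h \<in> (\<Union>h\<in>H. h <# U)" using h by blast
  qed (auto simp: l_coset_def absorb)
  moreover have "openin T (\<Union>h\<in>H. h <# U)"
    using openin_left_translate[OF U(1)] H by (intro openin_Union) blast
  ultimately show ?thesis by metis
qed

lemma compact_covered_by_left_cosets:
  assumes C: "compactin T C" and U: "openin T U" "\<one> \<in> U"
  obtains Q where "finite Q" "Q \<subseteq> C" "C \<subseteq> (\<Union>q\<in>Q. q <# U)"
proof -
  have Cc: "C \<subseteq> carrier G" using compactin_subset_topspace[OF C] topspace_eq by simp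
  have "c \<in> c <# U" if "c \<in> C" for c
  proof -
    have "c = c \<otimes> \<one>" using Cc that by auto
    then show ?thesis using U(2) unfolding l_coset_def by blast
  qed
  then have "C \<subseteq> \<Union> ((\<lambda>q. q <# U) ` C)" by blast
  moreover have "\<And>X. X \<in> (\<lambda>q. q <# U) ` C \<Longrightarrow> openin T X"
    using openin_left_translate[OF U(1)] Cc by blast
  ultimately obtain F where F: "finite F" "F \<subseteq> (\<lambda>q. q <# U) ` C" "C \<subseteq> \<Union> F"
    using compactinD[OF C, of "(\<lambda>q. q <# U) ` C"] by auto
  then obtain Q where "Q \<subseteq> C" "finite Q" "F = (\<lambda>q. q <# U) ` Q"
    using finite_subset_image[OF F(1,2)] by metis
  then show thesis using that F by auto
qed

end

section \<open>Coinvariants of a character\<close>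

text \<open>
  The kernel of the projection from \<open>V\<close> to its \<open>\<theta>\<close>-coinvariants under \<open>N\<close>.
\<close>

definition twisted_kernel ::
  "('r::field \<Rightarrow> 'v::ab_group_add \<Rightarrow> 'v) \<Rightarrow> 'v set \<Rightarrow> ('g \<Rightarrow> 'v \<Rightarrow> 'v) \<Rightarrow> 'g set \<Rightarrow> ('g \<Rightarrow> 'r) \<Rightarrow> 'v set"
  where
  "twisted_kernel scl V \<pi> N \<theta> = module.span scl {\<pi> n v - scl (\<theta> n) v | n v. n \<in> N \<and> v \<in> V}"

context representation
begin

lemmas V_add = vs.subspace_add[OF subspace_V]
  and V_scale = vs.subspace_scale[OF subspace_V]
  and V_diff = vs.subspace_diff[OF subspace_V]
  and V_zero = vs.subspace_0[OF subspace_V]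
  and V_sum = vs.subspace_sum[OF subspace_V]

lemma action_zero: "g \<in> carrier G \<Longrightarrow> \<pi> g 0 = 0"
  using action_scale[of g 0 0] V_zero by simp

lemma action_diff:
  assumes "g \<in> carrier G" "v \<in> V" "w \<in> V"
  shows "\<pi> g (v - w) = \<pi> g v - \<pi> g w"
  using action_add[of g "v - w" w] assms V_diff by (simp add: algebra_simps)

lemma action_sum:
  assumes g: "g \<in> carrier G" and p: "\<And>i. i \<in> I \<Longrightarrow> p i \<in> V"
  shows "\<pi> g (\<Sum>i\<in>I. p i) = (\<Sum>i\<in>I. \<pi> g (p i))"
  using p
proof (induction I rule: infinite_finite_induct)
  case (insert i I)
  then show ?case by (simp add: action_add[OF g] V_sum)
qed (simp_all add: action_zero g)

lemma action_inv_cancel: "\<lbrakk>g \<in> carrier G; v \<in> V\<rbrakk> \<Longrightarrow> \<pi> (inv g) (\<pi> g v) = v"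
  and action_inv_cancel': "\<lbrakk>g \<in> carrier G; v \<in> V\<rbrakk> \<Longrightarrow> \<pi> g (\<pi> (inv g) v) = v"
  using action_mult[of "inv g" g v] action_mult[of g "inv g" v] by (simp_all add: action_one)

lemma form_sum:
  assumes f: "f \<in> linear_forms scl V" and p: "\<And>i. i \<in> I \<Longrightarrow> p i \<in> V"
  shows "f (\<Sum>i\<in>I. scl (c i) (p i)) = (\<Sum>i\<in>I. c i * f (p i))"
  using p
proof (induction I rule: infinite_finite_induct)
  case (insert i I)
  then show ?case using f by (simp add: linear_forms_def V_sum V_scale)
next
  case empty
  have "f (scl 0 0) = 0 * f 0" using f V_zero unfolding linear_forms_def by blast
  then show ?case by simp
next
  case (infinite I)
  have "f (scl 0 0) = 0 * f 0" using f V_zero unfolding linear_forms_def by blast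
  then show ?case using infinite by simp
qed

lemma form_add: "\<lbrakk>f \<in> linear_forms scl V; v \<in> V; w \<in> V\<rbrakk> \<Longrightarrow> f (v + w) = f v + f w"
  and form_scale: "\<lbrakk>f \<in> linear_forms scl V; v \<in> V\<rbrakk> \<Longrightarrow> f (scl c v) = c * f v"
  and form_outside: "\<lbrakk>f \<in> linear_forms scl V; v \<notin> V\<rbrakk> \<Longrightarrow> f v = 0"
  by (auto simp: linear_forms_def)

lemma form_zero: "f \<in> linear_forms scl V \<Longrightarrow> f 0 = 0"
  using form_scale[of f 0 0] V_zero by simp

lemma form_diff: "\<lbrakk>f \<in> linear_forms scl V; v \<in> V; w \<in> V\<rbrakk> \<Longrightarrow> f (v - w) = f v - f w"
  using form_add[of f "v - w" w] V_diff[of v w] by simp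

lemma subspace_twisted_kernel: "vs.subspace (twisted_kernel scl V \<pi> N \<theta>)"
  by (simp add: twisted_kernel_def)

lemma twisted_kernel_generator:
  "\<lbrakk>n \<in> N; v \<in> V\<rbrakk> \<Longrightarrow> \<pi> n v - scl (\<theta> n) v \<in> twisted_kernel scl V \<pi> N \<theta>"
  unfolding twisted_kernel_def by (rule vs.span_base) blast

lemma twisted_kernel_induct:
  assumes u: "u \<in> twisted_kernel scl V \<pi> N \<theta>" and N: "N \<subseteq> carrier G"
    and gen: "\<And>n v. \<lbrakk>n \<in> N; v \<in> V\<rbrakk> \<Longrightarrow> P (\<pi> n v - scl (\<theta> n) v)"
    and zero: "P 0"
    and add: "\<And>v w. \<lbrakk>v \<in> V; w \<in> V; P v; P w\<rbrakk> \<Longrightarrow> P (v + w)"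
    and scale: "\<And>c v. \<lbrakk>v \<in> V; P v\<rbrakk> \<Longrightarrow> P (scl c v)"
  shows "P u"
proof -
  have "twisted_kernel scl V \<pi> N \<theta> \<subseteq> {v \<in> V. P v}"
    unfolding twisted_kernel_def
  proof (rule vs.span_minimal)
    show "{\<pi> n v - scl (\<theta> n) v |n v. n \<in> N \<and> v \<in> V} \<subseteq> {v \<in> V. P v}"
      using N by (auto intro!: gen V_diff V_scale action_closed)
    show "vs.subspace {v \<in> V. P v}"
      by (rule vs.subspaceI) (auto intro: zero add scale V_add V_scale V_zero)
  qed
  then show ?thesis using u by blast
qed

lemma Hom_character_eq_annihilator:
  assumes N: "N \<subseteq> carrier G"
  shows "Hom_character scl V \<pi> N \<theta> =
    {f \<in> linear_forms scl V. \<forall>u\<in>twisted_kernel scl V \<pi> N \<theta>. f u = 0}"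
proof (intro equalityI subsetI)
  fix f assume "f \<in> Hom_character scl V \<pi> N \<theta>"
  then have f: "f \<in> linear_forms scl V" "\<And>n v. \<lbrakk>n \<in> N; v \<in> V\<rbrakk> \<Longrightarrow> f (\<pi> n v) = \<theta> n * f v"
    by (auto simp: Hom_character_def)
  have "f u = 0" if "u \<in> twisted_kernel scl V \<pi> N \<theta>" for u
    using that N
  proof (rule twisted_kernel_induct[where P = "\<lambda>u. f u = 0"])
    fix n v assume nv: "n \<in> N" "v \<in> V"
    then show "f (\<pi> n v - scl (\<theta> n) v) = 0"
      using N by (simp add: form_diff[OF f(1)] action_closed subsetD V_scale form_scale[OF f(1)] f(2))
  qed (simp_all add: form_zero form_add form_scale f(1))
  then show "f \<in> {f \<in> linear_forms scl V. \<forall>u\<in>twisted_kernel scl V \<pi> N \<theta>. f u = 0}" using f by blast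
next
  fix f assume "f \<in> {f \<in> linear_forms scl V. \<forall>u\<in>twisted_kernel scl V \<pi> N \<theta>. f u = 0}"
  then have f: "f \<in> linear_forms scl V" "\<And>u. u \<in> twisted_kernel scl V \<pi> N \<theta> \<Longrightarrow> f u = 0"
    by auto
  have "f (\<pi> n v) = \<theta> n * f v" if nv: "n \<in> N" "v \<in> V" for n v
  proof -
    have "f (\<pi> n v - scl (\<theta> n) v) = 0" using f(2) twisted_kernel_generator nv by blast
    then show ?thesis
      using nv N by (simp add: form_diff[OF f(1)] action_closed subsetD V_scale form_scale[OF f(1)])
  qed
  then show "f \<in> Hom_character scl V \<pi> N \<theta>" using f(1) by (simp add: Hom_character_def)
qed

lemma separating_form_on_subspace:
  assumes K: "vs.subspace K" and u: "u \<in> V" "u \<notin> K"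
  obtains f where "f \<in> linear_forms scl V" "\<And>k. k \<in> K \<Longrightarrow> f k = 0" "f u = 1"
proof -
  obtain f where f: "Vector_Spaces.linear scl (*) f" "\<And>k. k \<in> K \<Longrightarrow> f k = 0" "f u = 1"
    using vs.separating_form[OF K u(2)] by metis
  interpret f: Vector_Spaces.linear scl "(*)" f by (rule f(1))
  have "(\<lambda>v. if v \<in> V then f v else 0) \<in> linear_forms scl V"
    by (auto simp: linear_forms_def V_add V_scale f.add f.scale)
  then show thesis using that[of "\<lambda>v. if v \<in> V then f v else 0"] f u by auto
qed

text \<open>
  The linear forms on \<open>V\<close> that vanish on the twisted kernel are the dual of the coinvariants, and a
  vector space and its dual have the same finite lower bounds for their dimensions. Given \<open>r\<close>
  independent forms, points that separate them are independent modulo the kernel; given vectors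
  independent modulo the kernel, too few forms would all vanish on some nontrivial combination, which
  a further form would detect.
\<close>

lemma le_d_character_iff:
  assumes N: "N \<subseteq> carrier G"
  shows "enat r \<le> d_character scl V \<pi> N \<theta> \<longleftrightarrow>
    codim_at_least scl V (twisted_kernel scl V \<pi> N \<theta>) r"
proof -
  define K where "K = twisted_kernel scl V \<pi> N \<theta>"
  define H where "H = Hom_character scl V \<pi> N \<theta>"
  have K: "vs.subspace K" unfolding K_def by (rule subspace_twisted_kernel)
  have H: "H = {f \<in> linear_forms scl V. \<forall>u\<in>K. f u = 0}"
    unfolding H_def K_def by (rule Hom_character_eq_annihilator[OF N])
  \<comment> \<open>A basis of \<open>H\<close>; the multiplicity is its cardinality, or \<open>\<infinity>\<close> if it is infinite.\<close>
  obtain F where F: "F \<subseteq> H" "fs.independent F" "H \<subseteq> fs.span F" "card F = fs.dim H"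
    by (rule fs.basis_exists)
  have fin: "finite F" if "finite B" "H \<subseteq> fs.span B" for B
    using fs.independent_span_bound[OF that(1) F(2)] F(1) that(2) by blast
  have d: "d_character scl V \<pi> N \<theta> = (if finite F then enat (card F) else \<infinity>)"
    unfolding d_character_def H_def[symmetric] Let_def using fin F(3,4) by auto
  have "enat r \<le> d_character scl V \<pi> N \<theta> \<longleftrightarrow> (finite F \<longrightarrow> r \<le> card F)"
    unfolding d by simp
  also have "\<dots> \<longleftrightarrow> codim_at_least scl V K r"
  proof
    assume "finite F \<longrightarrow> r \<le> card F"
    then obtain F' where F': "F' \<subseteq> F" "finite F'" "r \<le> card F'"
      using infinite_arbitrarily_large[of F r] by (metis order_refl)
    have "fs.independent F'" using fs.independent_mono[OF F(2) F'(1)] .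
    from independent_functions_separated_by_points[OF F'(2) this]
    obtain I where I: "finite I" "card F' \<le> card I"
      "\<And>c. (\<forall>f\<in>F'. (\<Sum>b\<in>I. c b * f b) = 0) \<Longrightarrow> \<forall>b\<in>I. c b = 0" by metis
    have F'H: "f \<in> linear_forms scl V" "\<And>u. u \<in> K \<Longrightarrow> f u = 0" if "f \<in> F'" for f
      using F' F(1) H that by auto
    \<comment> \<open>Separating points lie in \<open>V\<close>, as all forms are extended by zero outside \<open>V\<close>.\<close>
    have IV: "b \<in> V" if b: "b \<in> I" for b
    proof (rule ccontr)
      assume nb: "b \<notin> V"
      have "(\<Sum>x\<in>I. (if x = b then 1 else 0) * f x) = 0" if f: "f \<in> F'" for f
        by (rule sum.neutral) (use nb form_outside[OF F'H(1)[OF f]] in auto)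
      then have "\<forall>x\<in>I. (if x = b then 1 else 0 :: 'r) = 0"
        by (intro I(3)) blast
      then show False using b by auto
    qed
    have ind: "indep_mod scl K I id"
      unfolding indep_mod_def
    proof (intro allI impI)
      fix c assume c: "(\<Sum>i\<in>I. scl (c i) (id i)) \<in> K"
      have "(\<Sum>b\<in>I. c b * f b) = 0" if f: "f \<in> F'" for f
      proof -
        have "f (\<Sum>i\<in>I. scl (c i) (id i)) = (\<Sum>i\<in>I. c i * f (id i))"
          by (rule form_sum[OF F'H(1)[OF f]]) (simp add: IV)
        then show ?thesis using F'H(2)[OF f c] by simp
      qed
      then show "\<forall>i\<in>I. c i = 0" by (intro I(3)) blast
    qed
    show "codim_at_least scl V K r"
    proof (rule vs.codim_at_leastI[OF I(1) _ _ ind])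
      show "r \<le> card I" using I(2) F'(3) by simp
    qed (simp add: IV)
  next
    assume "codim_at_least scl V K r"
    then obtain p where p: "\<And>i. i < r \<Longrightarrow> p i \<in> V" and ind: "indep_mod scl K {..<r} p"
      unfolding codim_at_least_def by blast
    show "finite F \<longrightarrow> r \<le> card F"
    proof (rule impI, rule ccontr)
      assume finF: "finite F" and "\<not> r \<le> card F"
      then obtain c where c: "\<exists>a<r. c a \<noteq> 0" "\<forall>f\<in>F. (\<Sum>a<r. c a * f (p a)) = 0"
        using homogeneous_system_nontrivial_solution[OF finF, of "{..<r}" "\<lambda>a f. f (p a)"] by auto
      define u where "u = (\<Sum>a<r. scl (c a) (p a))"
      have uV: "u \<in> V" unfolding u_def by (intro V_sum V_scale p) simp
      have Fu: "f u = 0" if "f \<in> F" for f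
      proof -
        have "f \<in> linear_forms scl V" using that F(1) H by auto
        then have "f u = (\<Sum>a<r. c a * f (p a))" unfolding u_def by (intro form_sum) (auto intro: p)
        then show ?thesis using c(2) that by simp
      qed
      have "fs.subspace {f. f u = 0}" by (rule fs.subspaceI) (auto simp: fun_scale_def)
      then have "fs.span F \<subseteq> {f. f u = 0}" using Fu by (intro fs.span_minimal) blast
      with F(3) have Hsub: "H \<subseteq> {f. f u = 0}" by (rule subset_trans)
      have Hu: "f u = 0" if "f \<in> H" for f using subsetD[OF Hsub that] by simp
      have "u \<in> K"
      proof (rule ccontr)
        assume "u \<notin> K"
        obtain f where f: "f \<in> linear_forms scl V" "\<And>k. k \<in> K \<Longrightarrow> f k = 0" "f u = 1"
          by (rule separating_form_on_subspace[OF K uV \<open>u \<notin> K\<close>]) (rule that)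
        then have "f \<in> H" unfolding H by simp
        then show False using Hu f(3) by fastforce
      qed
      then have "\<forall>a\<in>{..<r}. c a = 0" using ind unfolding indep_mod_def u_def by blast
      then show False using c(1) by auto
    qed
  qed
  finally show ?thesis unfolding K_def .
qed

lemma twisted_kernel_mono:
  "M \<subseteq> N \<Longrightarrow> twisted_kernel scl V \<pi> M \<theta> \<subseteq> twisted_kernel scl V \<pi> N \<theta>"
  unfolding twisted_kernel_def by (rule vs.span_mono) blast

lemma center_action_commute:
  "\<lbrakk>z \<in> group_center G; g \<in> carrier G; v \<in> V\<rbrakk> \<Longrightarrow> \<pi> z (\<pi> g v) = \<pi> g (\<pi> z v)"
  using action_mult[of z g v] action_mult[of g z v] group_center_closed[of z]
    group_center_commute[of z g] by simp

text \<open>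
  A linear map that commutes with \<open>N\<close> sends generators of the twisted kernel to generators.
\<close>

lemma twisted_kernel_intertwiner:
  assumes N: "N \<subseteq> carrier G"
    and L: "\<And>v. v \<in> V \<Longrightarrow> L v \<in> V"
      "\<And>v w. \<lbrakk>v \<in> V; w \<in> V\<rbrakk> \<Longrightarrow> L (v + w) = L v + L w"
      "\<And>c v. v \<in> V \<Longrightarrow> L (scl c v) = scl c (L v)"
      "\<And>n v. \<lbrakk>n \<in> N; v \<in> V\<rbrakk> \<Longrightarrow> L (\<pi> n v) = \<pi> n (L v)"
    and u: "u \<in> twisted_kernel scl V \<pi> N \<theta>"
  shows "L u \<in> twisted_kernel scl V \<pi> N \<theta>"
  using u N
proof (rule twisted_kernel_induct[where P = "\<lambda>u. L u \<in> twisted_kernel scl V \<pi> N \<theta>"])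
  have L0: "L 0 = 0" using L(3)[of 0 0] V_zero by simp
  show "L 0 \<in> twisted_kernel scl V \<pi> N \<theta>"
    unfolding L0 by (rule vs.subspace_0[OF subspace_twisted_kernel])
  fix n v assume nv: "n \<in> N" "v \<in> V"
  have V: "\<pi> n v \<in> V" using nv N action_closed by blast
  have "L (\<pi> n v - scl (\<theta> n) v) = L (\<pi> n v) - L (scl (\<theta> n) v)"
    using L(2)[of "\<pi> n v - scl (\<theta> n) v" "scl (\<theta> n) v"] V V_scale[OF nv(2)] V_diff
    by (simp add: eq_diff_eq)
  also have "\<dots> = \<pi> n (L v) - scl (\<theta> n) (L v)" using nv by (simp add: L)
  finally show "L (\<pi> n v - scl (\<theta> n) v) \<in> twisted_kernel scl V \<pi> N \<theta>"
    using twisted_kernel_generator[OF nv(1) L(1)[OF nv(2)]] by simp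
qed (simp_all add: L vs.subspace_add vs.subspace_scale subspace_twisted_kernel)

text \<open>
  The vector \<open>x\<close> is the mean over \<open>a \<in> S \ M\<close> of \<open>\<theta>(a) \<pi>(a\<^sup>-\<^sup>1) v\<close>. The inverse makes the
  summand constant on right cosets of \<open>S\<close>, and each summand is congruent to \<open>v\<close> modulo the
  twisted kernel of \<open>M\<close>.
\<close>

lemma exists_average:
  assumes M: "subgroup M G" and S: "subgroup S G" "S \<subseteq> M"
    and index: "of_nat (card (rcosets\<^bsub>G\<lparr>carrier := M\<rparr>\<^esub> S)) \<noteq> (0::'r)"
    and \<theta>: "\<And>x y. \<lbrakk>x \<in> M; y \<in> M\<rbrakk> \<Longrightarrow> \<theta> (x \<otimes> y) = \<theta> x * \<theta> y" "\<And>x. x \<in> M \<Longrightarrow> \<theta> x \<noteq> 0"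
    and v: "v \<in> V" and fixed: "\<And>s. s \<in> S \<Longrightarrow> \<pi> s v = scl (\<theta> s) v"
  obtains x where "x \<in> vs.span ((\<lambda>m. \<pi> m v) ` M)" "\<And>n. n \<in> M \<Longrightarrow> \<pi> n x = scl (\<theta> n) x"
    "v - x \<in> twisted_kernel scl V \<pi> M \<theta>"
proof -
  let ?R = "rcosets\<^bsub>G\<lparr>carrier := M\<rparr>\<^esub> S"
  define m where "m = (of_nat (card ?R) :: 'r)"
  have m: "m \<noteq> 0" using index by (simp add: m_def)
  have fin: "finite ?R" using index by (metis card.infinite of_nat_0)
  have mem: "g \<in> carrier G" if "g \<in> M" for g using subgroup.mem_carrier[OF M that] .
  have \<theta>1: "\<theta> \<one> = 1"
  proof -
    have "\<theta> \<one> * \<theta> \<one> = \<theta> \<one>" using \<theta>(1)[of \<one> \<one>] subgroup.one_closed[OF M] by simp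
    then show ?thesis using \<theta>(2)[OF subgroup.one_closed[OF M]] by simp
  qed
  have \<theta>inv: "\<theta> (inv a) * \<theta> a = 1" "\<theta> a * \<theta> (inv a) = 1" if "a \<in> M" for a
    using \<theta>(1)[of "inv a" a] \<theta>(1)[of a "inv a"] subgroup.m_inv_closed[OF M that] that mem \<theta>1
    by simp_all
  define F where "F a = scl (\<theta> a) (\<pi> (inv a) v)" for a
  have FV: "F a \<in> V" if "a \<in> M" for a
    unfolding F_def using that mem v by (intro V_scale action_closed) auto
  have rep: "(SOME a. a \<in> C) \<in> M" if C: "C \<in> ?R" for C
  proof -
    obtain a where a: "a \<in> M" "C = S #> a" using C unfolding rcosets_subgroup_eq_image by blast
    obtain s where s: "s \<in> S" "(SOME b. b \<in> S #> a) = s \<otimes> a"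
      using coset_representative[OF S(1) M S(2) a(1)] .
    then show ?thesis using a S(2) subgroup.m_closed[OF M] by auto
  qed
  have Finv: "F (s \<otimes> a) = F a" if sa: "s \<in> S" "a \<in> M" for s a
  proof -
    have sM: "s \<in> M" "inv s \<in> S" "inv s \<in> M"
      using sa S subgroup.m_inv_closed[OF S(1)] by auto
    have "\<pi> (inv (s \<otimes> a)) v = \<pi> (inv a) (\<pi> (inv s) v)"
      using sa sM mem v by (simp add: inv_mult_group action_mult)
    also have "\<dots> = scl (\<theta> (inv s)) (\<pi> (inv a) v)"
      using fixed[OF sM(2)] sa mem v by (simp add: action_scale)
    finally show ?thesis
      using \<theta>(1)[OF sM(1) sa(2)] \<theta>inv(2)[OF sM(1)] by (simp add: F_def mult_ac)
  qed
  have shift: "\<pi> n (F a) = scl (\<theta> n) (F (a \<otimes> inv n))" if na: "n \<in> M" "a \<in> M" for n a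
  proof -
    have ni: "inv n \<in> M" using subgroup.m_inv_closed[OF M na(1)] .
    have "\<theta> n * \<theta> (a \<otimes> inv n) = \<theta> a"
      using \<theta>(1)[OF na(2) ni] \<theta>inv[OF na(1)] by (simp add: mult_ac)
    moreover have "\<pi> (inv (a \<otimes> inv n)) v = \<pi> n (\<pi> (inv a) v)"
      using na ni mem v by (simp add: inv_mult_group action_mult)
    moreover have "\<pi> n (F a) = scl (\<theta> a) (\<pi> n (\<pi> (inv a) v))"
      unfolding F_def using na mem v by (intro action_scale action_closed) auto
    ultimately show ?thesis by (simp add: F_def)
  qed
  define x where "x = scl (inverse m) (coset_sum G M S F)"
  have sumV: "coset_sum G M S F \<in> V" unfolding coset_sum_def by (intro V_sum FV rep)
  have "\<pi> n x = scl (\<theta> n) x" if n: "n \<in> M" for n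
  proof -
    have "\<pi> n (coset_sum G M S F) = (\<Sum>C\<in>?R. \<pi> n (F (SOME a. a \<in> C)))"
      unfolding coset_sum_def using n mem by (intro action_sum FV rep)
    also have "\<dots> = (\<Sum>C\<in>?R. scl (\<theta> n) (F ((SOME a. a \<in> C) \<otimes> inv n)))"
      using n rep by (intro sum.cong refl shift)
    also have "\<dots> = scl (\<theta> n) (coset_sum G M S (\<lambda>a. F (a \<otimes> inv n)))"
      by (simp add: coset_sum_def vs.scale_sum_right)
    also have "coset_sum G M S (\<lambda>a. F (a \<otimes> inv n)) = coset_sum G M S F"
      by (intro coset_sum_translate S M Finv subgroup.m_inv_closed[OF M n])
    finally show ?thesis
      unfolding x_def using n mem sumV by (simp add: action_scale mult.commute)
  qed
  moreover have "x \<in> vs.span ((\<lambda>g. \<pi> g v) ` M)"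
    unfolding x_def coset_sum_def F_def
    by (intro vs.span_scale vs.span_sum vs.span_base imageI subgroup.m_inv_closed[OF M] rep)
  moreover have "v - x \<in> twisted_kernel scl V \<pi> M \<theta>"
  proof -
    let ?K = "twisted_kernel scl V \<pi> M \<theta>"
    have "v - F a \<in> ?K" if a: "a \<in> M" for a
    proof -
      have ai: "inv a \<in> M" using subgroup.m_inv_closed[OF M a] .
      have "scl (- \<theta> a) (\<pi> (inv a) v - scl (\<theta> (inv a)) v) \<in> ?K"
        by (intro vs.subspace_scale[OF subspace_twisted_kernel] twisted_kernel_generator ai v)
      also have "scl (- \<theta> a) (\<pi> (inv a) v - scl (\<theta> (inv a)) v) = v - F a"
        using \<theta>inv[OF a] by (simp add: F_def vs.scale_right_diff_distrib)
      finally show ?thesis .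
    qed
    then have "(\<Sum>C\<in>?R. v - F (SOME a. a \<in> C)) \<in> ?K"
      using rep by (intro vs.subspace_sum[OF subspace_twisted_kernel]) blast
    then have "scl (inverse m) (\<Sum>C\<in>?R. v - F (SOME a. a \<in> C)) \<in> ?K"
      by (intro vs.subspace_scale[OF subspace_twisted_kernel])
    also have "(\<Sum>C\<in>?R. v - F (SOME a. a \<in> C)) = scl m v - coset_sum G M S F"
      by (simp add: sum_subtractf coset_sum_def m_def vs.sum_constant_scale)
    also have "scl (inverse m) (scl m v - coset_sum G M S F) = v - x"
      using m by (simp add: x_def vs.scale_right_diff_distrib)
    finally show ?thesis .
  qed
  ultimately show thesis using that by blast
qed

end

section \<open>Invariant pairings\<close>

locale invariant_pairing =
  V: representation G scl V \<pi> + W: representation G scl' W \<sigma>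
  for G (structure)
    and scl :: "'r::field \<Rightarrow> 'v::ab_group_add \<Rightarrow> 'v" and V \<pi>
    and scl' :: "'r \<Rightarrow> 'w::ab_group_add \<Rightarrow> 'w" and W \<sigma> +
  fixes \<beta> :: "'v \<Rightarrow> 'w \<Rightarrow> 'r"
  assumes left_add: "\<lbrakk>v \<in> V; v' \<in> V; w \<in> W\<rbrakk> \<Longrightarrow> \<beta> (v + v') w = \<beta> v w + \<beta> v' w"
    and left_scale: "\<lbrakk>v \<in> V; w \<in> W\<rbrakk> \<Longrightarrow> \<beta> (scl c v) w = c * \<beta> v w"
    and right_add: "\<lbrakk>v \<in> V; w \<in> W; w' \<in> W\<rbrakk> \<Longrightarrow> \<beta> v (w + w') = \<beta> v w + \<beta> v w'"
    and right_scale: "\<lbrakk>v \<in> V; w \<in> W\<rbrakk> \<Longrightarrow> \<beta> v (scl' c w) = c * \<beta> v w"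
    and invariant: "\<lbrakk>g \<in> carrier G; v \<in> V; w \<in> W\<rbrakk> \<Longrightarrow> \<beta> (\<pi> g v) (\<sigma> g w) = \<beta> v w"
begin

lemma left_form: "w \<in> W \<Longrightarrow> (\<lambda>v. if v \<in> V then \<beta> v w else 0) \<in> linear_forms scl V"
  by (auto simp: linear_forms_def left_add left_scale V.V_add V.V_scale)

lemma right_form: "v \<in> V \<Longrightarrow> (\<lambda>w. if w \<in> W then \<beta> v w else 0) \<in> linear_forms scl' W"
  by (auto simp: linear_forms_def right_add right_scale W.V_add W.V_scale)

lemma left_sum:
  assumes "\<And>i. i \<in> I \<Longrightarrow> p i \<in> V" "w \<in> W"
  shows "\<beta> (\<Sum>i\<in>I. scl (c i) (p i)) w = (\<Sum>i\<in>I. c i * \<beta> (p i) w)"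
proof -
  have "(\<Sum>i\<in>I. scl (c i) (p i)) \<in> V" using assms by (intro V.V_sum V.V_scale)
  then show ?thesis
    using V.form_sum[OF left_form[OF assms(2)], of I p c] assms(1) by (simp cong: sum.cong)
qed

lemma right_sum:
  assumes "\<And>i. i \<in> I \<Longrightarrow> p i \<in> W" "v \<in> V"
  shows "\<beta> v (\<Sum>i\<in>I. scl' (c i) (p i)) = (\<Sum>i\<in>I. c i * \<beta> v (p i))"
proof -
  have "(\<Sum>i\<in>I. scl' (c i) (p i)) \<in> W" using assms by (intro W.V_sum W.V_scale)
  then show ?thesis
    using W.form_sum[OF right_form[OF assms(2)], of I p c] assms(1) by (simp cong: sum.cong)
qed

lemma right_diff:
  "\<lbrakk>v \<in> V; w \<in> W; w' \<in> W\<rbrakk> \<Longrightarrow> \<beta> v (w - w') = \<beta> v w - \<beta> v w'"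
  using right_add[of v "w - w'" w'] W.V_diff[of w w'] by simp

lemma left_zero: "w \<in> W \<Longrightarrow> \<beta> 0 w = 0"
  using left_scale[of 0 w 0] V.V_zero by simp

lemma right_zero: "v \<in> V \<Longrightarrow> \<beta> v 0 = 0"
  using right_scale[of v 0 0] W.V_zero by simp

lemma adjoint:
  assumes "g \<in> carrier G" "v \<in> V" "w \<in> W"
  shows "\<beta> v (\<sigma> g w) = \<beta> (\<pi> (inv g) v) w"
  using invariant[of g "\<pi> (inv g) v" w] assms by (simp add: V.action_inv_cancel' V.action_closed)

text \<open>
  An element of the twisted kernel is a combination of finitely many generators, and a generator
  \<open>\<sigma>(n) w - \<theta>'(n) w\<close> is orthogonal to every vector on which \<open>n\<^sup>-\<^sup>1\<close> acts by \<open>\<theta>(n\<^sup>-\<^sup>1) = \<theta>'(n)\<close>.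
\<close>

lemma orthogonal_to_twisted_kernel_element:
  assumes N: "subgroup N G" and \<theta>': "\<And>n. n \<in> N \<Longrightarrow> \<theta>' n = \<theta> (inv n)"
    and u: "u \<in> twisted_kernel scl' W \<sigma> N \<theta>'"
  shows "\<exists>F. finite F \<and> F \<subseteq> N \<and>
    (\<forall>x\<in>V. (\<forall>n\<in>F. \<pi> n x = scl (\<theta> n) x) \<longrightarrow> \<beta> x u = 0)"
proof -
  have Nc: "N \<subseteq> carrier G" using subgroup.subset[OF N] .
  let ?P = "\<lambda>u. \<exists>F. finite F \<and> F \<subseteq> N \<and>
    (\<forall>x\<in>V. (\<forall>n\<in>F. \<pi> n x = scl (\<theta> n) x) \<longrightarrow> \<beta> x u = 0)"
  show "?P u"
    using u Nc
  proof (rule W.twisted_kernel_induct[where P = ?P])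
    fix n w assume nw: "n \<in> N" "w \<in> W"
    have n: "n \<in> carrier G" "inv n \<in> N" using nw Nc subgroup.m_inv_closed[OF N] by auto
    have "\<beta> x (\<sigma> n w - scl' (\<theta>' n) w) = 0"
      if "x \<in> V" "\<pi> (inv n) x = scl (\<theta> (inv n)) x" for x
      using that nw n
      by (simp add: right_diff right_scale adjoint left_scale \<theta>' W.action_closed W.V_scale)
    then show "?P (\<sigma> n w - scl' (\<theta>' n) w)" using n by (intro exI[of _ "{inv n}"]) auto
  next
    show "?P 0" by (intro exI[of _ "{}"]) (auto simp: right_zero)
  next
    fix v w assume vw: "v \<in> W" "w \<in> W" and "?P v" "?P w"
    then obtain F F' where "finite F" "F \<subseteq> N" "finite F'" "F' \<subseteq> N"
      "\<forall>x\<in>V. (\<forall>n\<in>F. \<pi> n x = scl (\<theta> n) x) \<longrightarrow> \<beta> x v = 0"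
      "\<forall>x\<in>V. (\<forall>n\<in>F'. \<pi> n x = scl (\<theta> n) x) \<longrightarrow> \<beta> x w = 0" by blast
    then show "?P (v + w)" using vw by (intro exI[of _ "F \<union> F'"]) (auto simp: right_add)
  next
    fix c v assume v: "v \<in> W" and "?P v"
    then obtain F where "finite F" "F \<subseteq> N"
      "\<forall>x\<in>V. (\<forall>n\<in>F. \<pi> n x = scl (\<theta> n) x) \<longrightarrow> \<beta> x v = 0" by blast
    then show "?P (scl' c v)" using v by (intro exI[of _ F]) (auto simp: right_scale)
  qed
qed

text \<open>
  The heart of the proof. The hypotheses record what is used of the representations: averages over
  arbitrarily large subgroups \<open>M\<close> of \<open>N\<close>; a vector \<open>w0\<close> whose translates separate \<open>V\<close>;
  coefficients against \<open>w0\<close> that vanish off finitely many translates, up to the center. The finite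
  set \<open>Q\<close> is fixed before \<open>M\<close> is chosen, which allows \<open>M\<close> to absorb all relations modulo the
  twisted kernel among the vectors \<open>\<sigma>(q) w0\<close>.
\<close>

lemma codim_twisted_kernel_transfer:
  assumes N: "subgroup N G" and \<theta>': "\<And>n. n \<in> N \<Longrightarrow> \<theta>' n = \<theta> (inv n)"
    and average: "\<And>F. \<lbrakk>finite F; F \<subseteq> N\<rbrakk> \<Longrightarrow> \<exists>M. F \<subseteq> M \<and> M \<subseteq> N \<and> subgroup M G \<and>
      (\<forall>v\<in>V. \<exists>x. x \<in> V.vs.span ((\<lambda>m. \<pi> m v) ` M) \<and> (\<forall>n\<in>M. \<pi> n x = scl (\<theta> n) x) \<and>
        v - x \<in> twisted_kernel scl V \<pi> M \<theta>)"
    and w0: "w0 \<in> W"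
    and faithful: "\<And>x. \<lbrakk>x \<in> V; \<And>g. g \<in> carrier G \<Longrightarrow> \<beta> x (\<sigma> g w0) = 0\<rbrakk> \<Longrightarrow> x = 0"
    and support: "\<And>v. v \<in> V \<Longrightarrow> \<exists>Q. finite Q \<and> Q \<subseteq> carrier G \<and>
      (\<forall>g\<in>carrier G. \<beta> v (\<sigma> g w0) \<noteq> 0 \<longrightarrow>
        (\<exists>q\<in>Q. \<exists>z\<in>group_center G. \<sigma> g w0 = \<sigma> z (\<sigma> q w0)))"
    and scalar: "(\<forall>z\<in>group_center G. \<exists>c. \<forall>w\<in>W. \<sigma> z w = scl' c w) \<or> r \<le> 1"
    and codim: "codim_at_least scl V (twisted_kernel scl V \<pi> N \<theta>) r"
  shows "codim_at_least scl' W (twisted_kernel scl' W \<sigma> N \<theta>') r"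
proof (rule ccontr)
  assume contra: "\<not> ?thesis"
  define K' where "K' = twisted_kernel scl' W \<sigma> N \<theta>'"
  have Nc: "N \<subseteq> carrier G" using subgroup.subset[OF N] .
  obtain p where p: "\<And>a. a < r \<Longrightarrow> p a \<in> V"
    and ind: "indep_mod scl (twisted_kernel scl V \<pi> N \<theta>) {..<r} p"
    using codim unfolding codim_at_least_def by blast
  have "\<forall>a\<in>{..<r}. \<exists>Q. finite Q \<and> Q \<subseteq> carrier G \<and>
      (\<forall>g\<in>carrier G. \<beta> (p a) (\<sigma> g w0) \<noteq> 0 \<longrightarrow>
        (\<exists>q\<in>Q. \<exists>z\<in>group_center G. \<sigma> g w0 = \<sigma> z (\<sigma> q w0)))"
    using support p by simp
  then obtain Qa where Qa: "\<forall>a\<in>{..<r}. finite (Qa a) \<and> Qa a \<subseteq> carrier G \<and>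
      (\<forall>g\<in>carrier G. \<beta> (p a) (\<sigma> g w0) \<noteq> 0 \<longrightarrow>
        (\<exists>q\<in>Qa a. \<exists>z\<in>group_center G. \<sigma> g w0 = \<sigma> z (\<sigma> q w0)))"
    unfolding bchoice_iff by (elim exE) (rule that)
  define Q where "Q = (\<Union>a<r. Qa a)"
  have Q: "finite Q" "Q \<subseteq> carrier G" unfolding Q_def using Qa by auto
  have supp: "\<exists>q\<in>Q. \<exists>z\<in>group_center G. \<sigma> g w0 = \<sigma> z (\<sigma> q w0)"
    if ag: "a < r" "g \<in> carrier G" "\<beta> (p a) (\<sigma> g w0) \<noteq> 0" for a g
  proof -
    obtain q z where "q \<in> Qa a" "z \<in> group_center G" "\<sigma> g w0 = \<sigma> z (\<sigma> q w0)"
      using bspec[OF Qa, of a] ag by auto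
    then show ?thesis using ag(1) unfolding Q_def by blast
  qed
  define P where "P q = \<sigma> q w0" for q
  have PW: "P q \<in> W" if "q \<in> Q" for q unfolding P_def using that Q w0 W.action_closed by blast
  have "\<exists>I \<alpha>. finite I \<and> I \<subseteq> Q \<and> indep_mod scl' K' I P \<and>
      (\<forall>q\<in>Q. P q - (\<Sum>i\<in>I. scl' (\<alpha> q i) (P i)) \<in> K')"
  proof (rule W.vs.maximal_indep_mod)
    show "W.vs.subspace K'" unfolding K'_def by (rule W.subspace_twisted_kernel)
    show "\<And>I. I \<subseteq> Q \<Longrightarrow> card I \<le> card Q" by (rule card_mono[OF Q(1)])
  qed
  then obtain I \<alpha> where I: "finite I" "I \<subseteq> Q" "indep_mod scl' K' I P"
    and rel: "\<forall>q\<in>Q. P q - (\<Sum>i\<in>I. scl' (\<alpha> q i) (P i)) \<in> K'"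
    by (elim exE conjE) (rule that)
  have cardI: "card I < r"
  proof (rule ccontr)
    assume "\<not> card I < r"
    then have "r \<le> card I" by simp
    from W.vs.codim_at_leastI[OF I(1) this _ I(3), of W] PW I(2) contra
    show False unfolding K'_def by blast
  qed
  let ?rel = "\<lambda>q. P q - (\<Sum>i\<in>I. scl' (\<alpha> q i) (P i))"
  have "\<forall>q\<in>Q. \<exists>F. finite F \<and> F \<subseteq> N \<and>
    (\<forall>x\<in>V. (\<forall>n\<in>F. \<pi> n x = scl (\<theta> n) x) \<longrightarrow> \<beta> x (?rel q) = 0)"
    using orthogonal_to_twisted_kernel_element[where \<theta> = \<theta> and \<theta>' = \<theta>', OF N \<theta>'] rel
    unfolding K'_def by simp
  then obtain Fq where Fq: "\<forall>q\<in>Q. finite (Fq q) \<and> Fq q \<subseteq> N \<and>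
    (\<forall>x\<in>V. (\<forall>n\<in>Fq q. \<pi> n x = scl (\<theta> n) x) \<longrightarrow> \<beta> x (?rel q) = 0)"
    unfolding bchoice_iff by (elim exE) (rule that)
  have "finite (\<Union>q\<in>Q. Fq q)" "(\<Union>q\<in>Q. Fq q) \<subseteq> N" using Fq Q by auto
  from average[OF this] obtain M where M: "(\<Union>q\<in>Q. Fq q) \<subseteq> M" "M \<subseteq> N" "subgroup M G"
    and av: "\<forall>v\<in>V. \<exists>x. x \<in> V.vs.span ((\<lambda>m. \<pi> m v) ` M) \<and> (\<forall>n\<in>M. \<pi> n x = scl (\<theta> n) x) \<and>
        v - x \<in> twisted_kernel scl V \<pi> M \<theta>"
    by (elim exE conjE) (rule that)
  have Mc: "m \<in> carrier G" if "m \<in> M" for m using subgroup.mem_carrier[OF M(3) that] .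
  have Minv: "inv m \<in> M" if "m \<in> M" for m using subgroup.m_inv_closed[OF M(3) that] .
  \<comment> \<open>By the choice of \<open>M\<close>, the relations modulo \<open>K'\<close> hold exactly on all vectors on which
    \<open>M\<close> acts by \<open>\<theta>\<close>.\<close>
  have rel0: "\<beta> x (?rel q) = 0" if x: "x \<in> V" "\<And>n. n \<in> M \<Longrightarrow> \<pi> n x = scl (\<theta> n) x" and q: "q \<in> Q" for x q
    using bspec[OF Fq q] x M(1) q by blast
  have "\<forall>a\<in>{..<r}. \<exists>x. x \<in> V.vs.span ((\<lambda>m. \<pi> m (p a)) ` M) \<and> (\<forall>n\<in>M. \<pi> n x = scl (\<theta> n) x) \<and>
        p a - x \<in> twisted_kernel scl V \<pi> M \<theta>"
    using av p by simp
  then obtain X where X: "\<forall>a\<in>{..<r}. X a \<in> V.vs.span ((\<lambda>m. \<pi> m (p a)) ` M) \<and>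
        (\<forall>n\<in>M. \<pi> n (X a) = scl (\<theta> n) (X a)) \<and> p a - X a \<in> twisted_kernel scl V \<pi> M \<theta>"
    unfolding bchoice_iff by (elim exE) (rule that)
  have XV: "X a \<in> V" if a: "a < r" for a
  proof -
    have "V.vs.span ((\<lambda>m. \<pi> m (p a)) ` M) \<subseteq> V"
      using V.action_closed p[OF a] Mc by (intro V.vs.span_minimal V.subspace_V) blast
    then show ?thesis using X a by blast
  qed
  \<comment> \<open>There are \<open>r\<close> unknowns and only \<open>card I < r\<close> conditions.\<close>
  obtain c where c: "\<exists>a\<in>{..<r}. c a \<noteq> 0" "\<forall>s\<in>I. (\<Sum>a<r. c a * \<beta> (X a) (P s)) = 0"
    using homogeneous_system_nontrivial_solution[OF I(1), of "{..<r}" "\<lambda>a s. \<beta> (X a) (P s)"] cardI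
    by auto
  define x where "x = (\<Sum>a<r. scl (c a) (X a))"
  have xV: "x \<in> V" unfolding x_def by (intro V.V_sum V.V_scale XV) simp
  have \<beta>x: "\<beta> x w = (\<Sum>a<r. c a * \<beta> (X a) w)" if "w \<in> W" for w
    unfolding x_def by (rule left_sum[OF _ that]) (simp add: XV)
  have xM: "\<pi> n x = scl (\<theta> n) x" if n: "n \<in> M" for n
  proof -
    have "\<pi> n x = (\<Sum>a<r. \<pi> n (scl (c a) (X a)))"
      unfolding x_def by (rule V.action_sum) (simp_all add: Mc n XV V.V_scale)
    also have "\<dots> = (\<Sum>a<r. scl (\<theta> n) (scl (c a) (X a)))"
      using X n by (intro sum.cong refl) (simp add: V.action_scale Mc XV mult.commute)
    finally show ?thesis by (simp add: x_def V.vs.scale_sum_right)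
  qed
  \<comment> \<open>The translate \<open>z\<close> is moved to the other side, where \<open>y = \<pi>(z\<^sup>-\<^sup>1) x\<close> is again a vector
    on which \<open>M\<close> acts by \<open>\<theta>\<close>.\<close>
  have central: "\<beta> x (\<sigma> z (P q)) = 0" if z: "z \<in> group_center G" and q: "q \<in> Q" for z q
  proof -
    have zc: "z \<in> carrier G" using V.group_center_closed[OF z] .
    define y where "y = \<pi> (inv z) x"
    have yV: "y \<in> V" unfolding y_def using zc xV by (simp add: V.action_closed)
    have \<beta>y: "\<beta> y w = \<beta> x (\<sigma> z w)" if "w \<in> W" for w
      unfolding y_def using adjoint[OF zc xV that] by simp
    have yM: "\<pi> n y = scl (\<theta> n) y" if n: "n \<in> M" for n
    proof -
      have "\<pi> n y = \<pi> (inv z) (\<pi> n x)"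
        unfolding y_def
        using V.center_action_commute[OF V.group_center_inv[OF z] Mc[OF n] xV] by simp
      then show ?thesis using xM[OF n] zc xV by (simp add: y_def V.action_scale)
    qed
    have zero: "\<beta> y (P s) = 0" if s: "s \<in> I" for s
    proof -
      have sW: "P s \<in> W" using PW I(2) s by blast
      \<comment> \<open>If \<open>r \<le> 1\<close> then \<open>I\<close> is empty; otherwise \<open>Z\<close> acts by scalars.\<close>
      have "\<not> r \<le> 1" using cardI s I(1) by (cases "card I") auto
      then obtain k where "\<forall>w\<in>W. \<sigma> z w = scl' k w" using scalar z by blast
      then have "\<beta> y (P s) = k * \<beta> x (P s)" using \<beta>y[OF sW] sW xV by (simp add: right_scale)
      then show ?thesis using \<beta>x[OF sW] c(2) s by simp
    qed
    have sumW: "(\<Sum>i\<in>I. scl' (\<alpha> q i) (P i)) \<in> W" using PW I(2) by (intro W.V_sum W.V_scale) blast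
    have "\<beta> y (\<Sum>i\<in>I. scl' (\<alpha> q i) (P i)) = (\<Sum>i\<in>I. \<alpha> q i * \<beta> y (P i))"
      using PW I(2) yV by (intro right_sum) blast+
    then have "\<beta> y (\<Sum>i\<in>I. scl' (\<alpha> q i) (P i)) = 0" using zero by simp
    then have "\<beta> y (P q) = 0"
      using rel0[OF yV yM q] right_diff[OF yV PW[OF q] sumW] by simp
    then show ?thesis using \<beta>y[OF PW[OF q]] by simp
  qed
  \<comment> \<open>\<open>x\<close> is a combination of the \<open>\<pi>(m) (p a)\<close>, so a value at \<open>g\<close> can be nonzero only if
    \<open>\<sigma>(m\<^sup>-\<^sup>1 g) w0\<close> lies in \<open>Z Q w0\<close> for some \<open>m \<in> M\<close>; then equivariance applies.\<close>
  have "\<beta> x (\<sigma> g w0) = 0" if g: "g \<in> carrier G" for g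
  proof (cases "\<forall>m\<in>M. \<forall>a<r. \<beta> (\<pi> m (p a)) (\<sigma> g w0) = 0")
    case True
    have gW: "\<sigma> g w0 \<in> W" using g w0 W.action_closed by blast
    have "\<beta> (X a) (\<sigma> g w0) = 0" if a: "a < r" for a
    proof -
      have "V.vs.span ((\<lambda>m. \<pi> m (p a)) ` M) \<subseteq> {v \<in> V. \<beta> v (\<sigma> g w0) = 0}"
      proof (rule V.vs.span_minimal)
        show "(\<lambda>m. \<pi> m (p a)) ` M \<subseteq> {v \<in> V. \<beta> v (\<sigma> g w0) = 0}"
          using True a V.action_closed p[OF a] Mc by auto
        show "V.vs.subspace {v \<in> V. \<beta> v (\<sigma> g w0) = 0}"
          using gW by (intro V.vs.subspaceI)
            (auto simp: V.V_zero V.V_add V.V_scale left_zero left_add left_scale)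
      qed
      then show ?thesis using X a by blast
    qed
    then show ?thesis using \<beta>x[OF gW] by simp
  next
    case False
    then obtain m a where m: "m \<in> M" and a: "a < r" and ne: "\<beta> (\<pi> m (p a)) (\<sigma> g w0) \<noteq> 0"
      by blast
    have mc: "m \<in> carrier G" "inv m \<in> carrier G" "inv m \<in> M" using m Mc Minv by auto
    have gW: "\<sigma> g w0 \<in> W" using g w0 W.action_closed by blast
    have mult: "\<sigma> (inv m \<otimes> g) w0 = \<sigma> (inv m) (\<sigma> g w0)" using mc g w0 by (simp add: W.action_mult)
    have "\<beta> (\<pi> m (p a)) (\<sigma> g w0) = \<beta> (p a) (\<sigma> (inv m \<otimes> g) w0)"
      unfolding mult using adjoint[OF mc(2) p[OF a] gW] mc by simp
    then have "\<beta> (p a) (\<sigma> (inv m \<otimes> g) w0) \<noteq> 0" using ne by simp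
    then obtain q z where qz: "q \<in> Q" "z \<in> group_center G" "\<sigma> (inv m \<otimes> g) w0 = \<sigma> z (P q)"
      unfolding P_def using supp[OF a, of "inv m \<otimes> g"] mc g by auto
    have "\<beta> x (\<sigma> g w0) = \<beta> (\<pi> (inv m) x) (\<sigma> (inv m) (\<sigma> g w0))"
      using invariant[OF mc(2) xV gW] by simp
    also have "\<dots> = \<theta> (inv m) * \<beta> x (\<sigma> z (P q))"
      unfolding xM[OF mc(3)] mult[symmetric] qz(3)
      using left_scale xV PW[OF qz(1)] W.action_closed V.group_center_closed[OF qz(2)] by blast
    also have "\<dots> = 0" using central[OF qz(2,1)] by simp
    finally show ?thesis .
  qed
  then have x0: "x = 0" using faithful[OF xV] by blast
  have "(\<Sum>a<r. scl (c a) (p a - X a)) \<in> twisted_kernel scl V \<pi> N \<theta>"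
    using X V.twisted_kernel_mono[OF M(2)]
    by (intro V.vs.subspace_sum V.vs.subspace_scale V.subspace_twisted_kernel) blast
  also have "(\<Sum>a<r. scl (c a) (p a - X a)) = (\<Sum>a<r. scl (c a) (p a)) - x"
    by (simp add: x_def V.vs.scale_right_diff_distrib sum_subtractf)
  finally have "\<forall>a\<in>{..<r}. c a = 0" using ind x0 unfolding indep_mod_def by simp
  then show False using c(1) by blast
qed

end

lemma invariant_pairing_flip:
  assumes "invariant_pairing G scl V \<pi> scl' W \<sigma> \<beta>"
  shows "invariant_pairing G scl' W \<sigma> scl V \<pi> (\<lambda>w v. \<beta> v w)"
proof -
  interpret invariant_pairing G scl V \<pi> scl' W \<sigma> \<beta> by (rule assms)
  show ?thesis
    by unfold_locales (auto simp: left_add left_scale right_add right_scale invariant)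
qed

section \<open>The contragredient representation\<close>

lemma smooth_character_inverse:
  assumes "smooth_character N T \<theta>"
  shows "smooth_character N T (\<lambda>n. inverse (\<theta> n))"
  using assms by (auto simp: smooth_character_def)

lemma (in group) smooth_character_inv:
  assumes N: "subgroup N G" and \<theta>: "smooth_character (G\<lparr>carrier := N\<rparr>) T \<theta>" and n: "n \<in> N"
  shows "\<theta> (inv n) = inverse (\<theta> n)"
proof -
  have mult: "\<theta> (x \<otimes> y) = \<theta> x * \<theta> y" and ne: "\<theta> x \<noteq> 0" if "x \<in> N" "y \<in> N" for x y
    using \<theta> that unfolding smooth_character_def by auto
  have one: "\<one> \<in> N" using subgroup.one_closed[OF N] .
  have "\<theta> \<one> = 1" using mult[OF one one] ne[OF one one] by simp
  moreover have "\<theta> (inv n \<otimes> n) = \<theta> (inv n) * \<theta> n"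
    using mult[OF subgroup.m_inv_closed[OF N n] n] .
  ultimately have "\<theta> (inv n) * \<theta> n = 1" using subgroup.mem_carrier[OF N n] by simp
  then show ?thesis using ne[OF n n] by (simp add: field_simps)
qed

context smooth_representation
begin

lemma contragredient_linear_form:
  assumes g: "g \<in> carrier G" and f: "f \<in> linear_forms scl V"
  shows "contragredient_action G V \<pi> g f \<in> linear_forms scl V"
  using f g
  by (auto simp: linear_forms_def contragredient_action_def V_add V_scale action_add action_scale
      action_closed)

lemma contragredient_mult:
  assumes "g \<in> carrier G" "h \<in> carrier G"
  shows "contragredient_action G V \<pi> (g \<otimes> h) f =
    contragredient_action G V \<pi> g (contragredient_action G V \<pi> h f)"
  using assms by (auto simp: contragredient_action_def inv_mult_group action_mult action_closed)

lemma contragredient_one: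
  "f \<in> linear_forms scl V \<Longrightarrow> contragredient_action G V \<pi> \<one> f = f"
  by (auto simp: contragredient_action_def action_one form_outside)

lemma contragredient_add:
  "contragredient_action G V \<pi> g (f + f') =
    contragredient_action G V \<pi> g f + contragredient_action G V \<pi> g f'"
  by (auto simp: contragredient_action_def)

lemma contragredient_scale:
  "contragredient_action G V \<pi> g (fun_scale c f) = fun_scale c (contragredient_action G V \<pi> g f)"
  by (auto simp: contragredient_action_def fun_scale_def)

text \<open>
  The stabilizer of \<open>f\<close> is a union of left translates of \<open>U\<close>.
\<close>

lemma smooth_dualI:
  assumes f: "f \<in> linear_forms scl V" and U: "openin T U" "\<one> \<in> U"
    and fixed: "\<And>u. u \<in> U \<Longrightarrow> contragredient_action G V \<pi> u f = f"
  shows "f \<in> smooth_dual G T scl V \<pi>"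
proof -
  have Uc: "U \<subseteq> carrier G" using openin_subset[OF U(1)] topspace_eq by simp
  have "openin T {g \<in> carrier G. contragredient_action G V \<pi> g f = f}"
    by (rule openin_if_absorbs_open[OF _ U]) (use Uc fixed in \<open>auto simp: contragredient_mult\<close>)
  then show ?thesis using f by (simp add: smooth_dual_def)
qed

lemma linear_form_of_smooth_dual: "f \<in> smooth_dual G T scl V \<pi> \<Longrightarrow> f \<in> linear_forms scl V"
  and openin_contragredient_stabilizer: "f \<in> smooth_dual G T scl V \<pi> \<Longrightarrow>
    openin T {g \<in> carrier G. contragredient_action G V \<pi> g f = f}"
  by (auto simp: smooth_dual_def)

text \<open>
  The stabilizer of a sum contains the intersection of the stabilizers, and the stabilizer of a
  translate is a conjugate of the stabilizer.
\<close>

lemma smooth_representation_contragredient: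
  "smooth_representation G T fun_scale (smooth_dual G T scl V \<pi>) (contragredient_action G V \<pi>)"
proof (intro smooth_representation.intro representation.intro)
  let ?W = "smooth_dual G T scl V \<pi>" and ?c = "contragredient_action G V \<pi>"
  show "topological_group G T" by (rule topological_group_axioms)
  show "group G" by (rule group_axioms)
  show "vector_space (fun_scale :: 'r \<Rightarrow> ('v \<Rightarrow> 'r) \<Rightarrow> 'v \<Rightarrow> 'r)" by (rule vector_space_fun_scale)
  have topspace: "carrier G = topspace T" using topspace_eq by simp
  have add: "f + f' \<in> ?W" if ff: "f \<in> ?W" "f' \<in> ?W" for f f'
  proof (rule smooth_dualI)
    show "f + f' \<in> linear_forms scl V"
      using ff[THEN linear_form_of_smooth_dual] by (auto simp: linear_forms_def algebra_simps)
    show "openin T ({g \<in> carrier G. ?c g f = f} \<inter> {g \<in> carrier G. ?c g f' = f'})"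
      using ff by (intro openin_Int openin_contragredient_stabilizer)
  qed (use ff in \<open>auto simp: contragredient_add contragredient_one linear_form_of_smooth_dual\<close>)
  have scale: "fun_scale c f \<in> ?W" if f: "f \<in> ?W" for c f
  proof (rule smooth_dualI)
    show "fun_scale c f \<in> linear_forms scl V"
      using linear_form_of_smooth_dual[OF f] by (auto simp: linear_forms_def fun_scale_def algebra_simps)
    show "openin T {g \<in> carrier G. ?c g f = f}"
      using f by (intro openin_contragredient_stabilizer)
  qed (use f in \<open>auto simp: contragredient_scale contragredient_one linear_form_of_smooth_dual\<close>)
  have zero: "0 \<in> ?W"
  proof (rule smooth_dualI[of _ "carrier G"])
    show "openin T (carrier G)" using topspace by simp
  qed (auto simp: linear_forms_def contragredient_action_def)
  have closed: "?c g f \<in> ?W" if g: "g \<in> carrier G" and f: "f \<in> ?W" for g f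
  proof -
    have lf: "f \<in> linear_forms scl V" using linear_form_of_smooth_dual[OF f] .
    show ?thesis
    proof (rule smooth_dualI)
      show "?c g f \<in> linear_forms scl V" using contragredient_linear_form[OF g lf] .
      show "openin T {x \<in> carrier G. inv g \<otimes> x \<otimes> g \<in> {x \<in> carrier G. ?c x f = f}}"
        by (rule openin_conjugate[OF openin_contragredient_stabilizer[OF f] g])
      show "\<one> \<in> {x \<in> carrier G. inv g \<otimes> x \<otimes> g \<in> {x \<in> carrier G. ?c x f = f}}"
        using g lf by (simp add: contragredient_one)
      fix x assume "x \<in> {x \<in> carrier G. inv g \<otimes> x \<otimes> g \<in> {x \<in> carrier G. ?c x f = f}}"
      then have x: "x \<in> carrier G" "?c (inv g \<otimes> x \<otimes> g) f = f" by auto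
      have "g \<otimes> (inv g \<otimes> x \<otimes> g) = x \<otimes> g" using g x by (simp add: m_assoc[symmetric])
      then have "?c x (?c g f) = ?c g (?c (inv g \<otimes> x \<otimes> g) f)"
        using g x(1) by (simp add: contragredient_mult[symmetric])
      then show "?c x (?c g f) = ?c g f" using x by simp
    qed
  qed
  show "representation_axioms G fun_scale ?W ?c"
  proof
    show "fs.subspace ?W" by (rule fs.subspaceI) (auto intro: zero add scale)
  qed (auto intro: closed
      simp: contragredient_add contragredient_scale contragredient_one contragredient_mult
        linear_form_of_smooth_dual)
  show "smooth_representation_axioms G T ?W ?c"
    by unfold_locales (rule openin_contragredient_stabilizer)
qed

lemma subgroup_pointwise_stabilizer:
  assumes U: "subgroup U G" and D: "D \<subseteq> V"
  shows "subgroup {u \<in> U. \<forall>y\<in>D. \<pi> u y = y} G"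
proof (rule subgroupI)
  have Uc: "U \<subseteq> carrier G" using subgroup.subset[OF U] .
  show "{u \<in> U. \<forall>y\<in>D. \<pi> u y = y} \<subseteq> carrier G" using Uc by blast
  have "\<one> \<in> {u \<in> U. \<forall>y\<in>D. \<pi> u y = y}"
    using subgroup.one_closed[OF U] D by (auto simp: action_one)
  then show "{u \<in> U. \<forall>y\<in>D. \<pi> u y = y} \<noteq> {}" by blast
  fix a assume a: "a \<in> {u \<in> U. \<forall>y\<in>D. \<pi> u y = y}"
  have "\<pi> (inv a) y = y" if y: "y \<in> D" for y
  proof -
    have "\<pi> a y = y" "y \<in> V" "a \<in> carrier G" using a y D Uc by auto
    then show ?thesis using action_inv_cancel[of a y] by simp
  qed
  then show "inv a \<in> {u \<in> U. \<forall>y\<in>D. \<pi> u y = y}"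
    using a subgroup.m_inv_closed[OF U] by auto
  fix b assume b: "b \<in> {u \<in> U. \<forall>y\<in>D. \<pi> u y = y}"
  then show "a \<otimes> b \<in> {u \<in> U. \<forall>y\<in>D. \<pi> u y = y}"
    using a D Uc subgroup.m_closed[OF U] by (auto simp: action_mult subsetD)
qed

lemma openin_pointwise_stabilizer:
  assumes U: "openin T U" and D: "finite D" "D \<subseteq> V"
  shows "openin T {u \<in> U. \<forall>y\<in>D. \<pi> u y = y}"
proof -
  have Uc: "U \<subseteq> carrier G" using openin_subset[OF U] topspace_eq by simp
  have "openin T (U \<inter> ((\<Inter>y\<in>D. {g \<in> carrier G. \<pi> g y = y}) \<inter> topspace T))"
    using D open_stabilizer by (intro openin_Int U openin_INT) auto
  also have "U \<inter> ((\<Inter>y\<in>D. {g \<in> carrier G. \<pi> g y = y}) \<inter> topspace T) = {u \<in> U. \<forall>y\<in>D. \<pi> u y = y}"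
    using Uc topspace_eq by auto
  finally show ?thesis .
qed

text \<open>
  A finite subset of \<open>N\<close> is compact, hence contained in some compact open \<open>M\<close> of invertible
  pro-order. The elements of \<open>M\<close> that fix \<open>v\<close> and on which \<open>\<theta>\<close> is trivial form an open
  subgroup of invertible index, over whose cosets \<open>v\<close> can be averaged.
\<close>

lemma exists_average_of_exhausted:
  fixes \<theta> :: "'g \<Rightarrow> 'r"
  assumes N: "subgroup N G"
    and exh: "exhausted_by_invertible_pro_order TYPE('r) (G\<lparr>carrier := N\<rparr>) (subtopology T N)"
    and \<theta>: "smooth_character (G\<lparr>carrier := N\<rparr>) (subtopology T N) \<theta>"
    and F: "finite F" "F \<subseteq> N"
  shows "\<exists>M. F \<subseteq> M \<and> M \<subseteq> N \<and> subgroup M G \<and>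
      (\<forall>v\<in>V. \<exists>x. x \<in> vs.span ((\<lambda>m. \<pi> m v) ` M) \<and> (\<forall>n\<in>M. \<pi> n x = scl (\<theta> n) x) \<and>
        v - x \<in> twisted_kernel scl V \<pi> M \<theta>)"
proof -
  let ?TN = "subtopology T N"
  have Nc: "N \<subseteq> carrier G" using subgroup.subset[OF N] .
  have "compactin ?TN F"
    using F Nc by (intro finite_imp_compactin) (auto simp: topspace_eq)
  then obtain M where M: "F \<subseteq> M" "subgroup M (G\<lparr>carrier := N\<rparr>)"
    and inv: "invertible_pro_order TYPE('r) (G\<lparr>carrier := M\<rparr>) (subtopology ?TN M)"
    using exh unfolding exhausted_by_invertible_pro_order_def
      compact_open_subgroup_invertible_pro_order_def by auto
  have MG: "subgroup M G" using incl_subgroup[OF N M(2)] .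
  have MN: "M \<subseteq> N" using subgroup.subset[OF M(2)] by simp
  have \<theta>ne: "\<theta> x \<noteq> 0" and \<theta>mult: "\<theta> (x \<otimes> y) = \<theta> x * \<theta> y" if "x \<in> M" "y \<in> M" for x y
    using \<theta> MN that unfolding smooth_character_def by auto
  have \<theta>open: "openin ?TN {x \<in> N. \<theta> x = 1}" using \<theta> unfolding smooth_character_def by simp
  have \<theta>1: "\<theta> \<one> = 1"
    using \<theta>mult[of \<one> \<one>] \<theta>ne[of \<one> \<one>] subgroup.one_closed[OF MG] by simp
  have "\<exists>x. x \<in> vs.span ((\<lambda>m. \<pi> m v) ` M) \<and> (\<forall>n\<in>M. \<pi> n x = scl (\<theta> n) x) \<and>
        v - x \<in> twisted_kernel scl V \<pi> M \<theta>" if v: "v \<in> V" for v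
  proof -
    define S where "S = {u \<in> M. \<theta> u = 1} \<inter> {u \<in> M. \<forall>y\<in>{v}. \<pi> u y = y}"
    have ker: "subgroup {u \<in> M. \<theta> u = 1} G"
    proof (rule subgroupI)
      show "{u \<in> M. \<theta> u = 1} \<subseteq> carrier G" using subgroup.subset[OF MG] by blast
      show "{u \<in> M. \<theta> u = 1} \<noteq> {}" using \<theta>1 subgroup.one_closed[OF MG] by blast
      fix a assume a: "a \<in> {u \<in> M. \<theta> u = 1}"
      then have "\<theta> (a \<otimes> inv a) = \<theta> a * \<theta> (inv a)"
        using \<theta>mult subgroup.m_inv_closed[OF MG] by blast
      then show "inv a \<in> {u \<in> M. \<theta> u = 1}"
        using a subgroup.m_inv_closed[OF MG] subgroup.mem_carrier[OF MG] \<theta>1 by auto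
      fix b assume "b \<in> {u \<in> M. \<theta> u = 1}"
      then show "a \<otimes> b \<in> {u \<in> M. \<theta> u = 1}" using a \<theta>mult subgroup.m_closed[OF MG] by auto
    qed
    have S: "subgroup S G" "S \<subseteq> M"
      unfolding S_def using subgroups_Inter_pair[OF ker subgroup_pointwise_stabilizer[OF MG, of "{v}"]] v
      by auto
    have "openin (subtopology ?TN M)
        (M \<inter> ({x \<in> N. \<theta> x = 1} \<inter> (N \<inter> {g \<in> carrier G. \<pi> g v = v})))"
      by (intro openin_subtopology_Int2 openin_Int \<theta>open open_stabilizer v)
    also have "M \<inter> ({x \<in> N. \<theta> x = 1} \<inter> (N \<inter> {g \<in> carrier G. \<pi> g v = v})) = S"
      using MN Nc by (auto simp: S_def)
    finally have "(of_nat (card (rcosets\<^bsub>G\<lparr>carrier := M\<rparr>\<^esub> S)) :: 'r) dvd 1"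
      using inv subgroup_incl[OF S(1) MG S(2)] unfolding invertible_pro_order_def by blast
    then have idx: "(of_nat (card (rcosets\<^bsub>G\<lparr>carrier := M\<rparr>\<^esub> S)) :: 'r) \<noteq> 0" by auto
    have fixed: "\<pi> s v = scl (\<theta> s) v" if "s \<in> S" for s using that by (simp add: S_def)
    obtain x where "x \<in> vs.span ((\<lambda>m. \<pi> m v) ` M)" "\<And>n. n \<in> M \<Longrightarrow> \<pi> n x = scl (\<theta> n) x"
      "v - x \<in> twisted_kernel scl V \<pi> M \<theta>"
      by (rule exists_average[OF MG S idx \<theta>mult _ v fixed]) (simp_all add: \<theta>ne that)
    then show ?thesis by blast
  qed
  then show ?thesis using M(1) MN MG by blast
qed

section \<open>Existence of smooth linear forms\<close>

text \<open>
  The orbit of a smooth vector under \<open>U\<close> is finite, because its stabilizer has an index that is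
  nonzero in the field, hence finite. Finitely many generators of the twisted kernel thus
  live on a finite \<open>U\<close>-stable set \<open>D\<close>.
\<close>

lemma finite_stable_set_spanning:
  assumes U: "subgroup U G" "openin T U"
    and index: "\<And>S. \<lbrakk>subgroup S G; openin T S; S \<subseteq> U\<rbrakk> \<Longrightarrow>
      of_nat (card (rcosets\<^bsub>G\<lparr>carrier := U\<rparr>\<^esub> S)) \<noteq> (0::'r)"
    and w: "w \<in> twisted_kernel scl V \<pi> U (\<lambda>_. 1)"
  shows "\<exists>D. finite D \<and> D \<subseteq> V \<and> (\<forall>u\<in>U. \<forall>y\<in>D. \<pi> u y \<in> D) \<and>
    w \<in> vs.span {\<pi> u y - y | u y. u \<in> U \<and> y \<in> D}"
    (is "?P w")
proof -
  have Uc: "U \<subseteq> carrier G" using subgroup.subset[OF U(1)] .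
  let ?gen = "\<lambda>D. {\<pi> u y - y | u y. u \<in> U \<and> y \<in> D}"
  show "?P w"
    using w Uc
  proof (rule twisted_kernel_induct[where P = ?P])
    fix n v assume n: "n \<in> U" and v: "v \<in> V"
    define D where "D = (\<lambda>u. \<pi> u v) ` U"
    define S where "S = {u \<in> U. \<forall>y\<in>{v}. \<pi> u y = y}"
    have S: "subgroup S G" "openin T S" "S \<subseteq> U"
      unfolding S_def using subgroup_pointwise_stabilizer[OF U(1), of "{v}"]
        openin_pointwise_stabilizer[OF U(2), of "{v}"] v by auto
    have fin: "finite (rcosets\<^bsub>G\<lparr>carrier := U\<rparr>\<^esub> S)"
      using index[OF S] by (metis card.infinite of_nat_0)
    have "D \<subseteq> (\<lambda>C. \<pi> (inv (SOME a. a \<in> C)) v) ` (rcosets\<^bsub>G\<lparr>carrier := U\<rparr>\<^esub> S)"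
    proof
      fix y assume "y \<in> D"
      then obtain u where u: "u \<in> U" "y = \<pi> u v" unfolding D_def by blast
      have ui: "inv u \<in> U" using subgroup.m_inv_closed[OF U(1) u(1)] .
      obtain s where s: "s \<in> S" "(SOME b. b \<in> S #> inv u) = s \<otimes> inv u"
        using coset_representative[OF S(1) U(1) S(3) ui] .
      have si: "inv s \<in> S" "inv s \<in> carrier G" "s \<in> carrier G"
        using subgroup.m_inv_closed[OF S(1) s(1)] s(1) S(3) Uc by auto
      have uc: "u \<in> carrier G" using u Uc by blast
      have "\<pi> (inv (s \<otimes> inv u)) v = \<pi> u (\<pi> (inv s) v)"
        using uc si v by (simp add: inv_mult_group action_mult)
      also have "\<dots> = y" using si u by (simp add: S_def)
      finally have "y = \<pi> (inv (SOME b. b \<in> S #> inv u)) v" using s by simp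
      then show "y \<in> (\<lambda>C. \<pi> (inv (SOME a. a \<in> C)) v) ` (rcosets\<^bsub>G\<lparr>carrier := U\<rparr>\<^esub> S)"
        unfolding rcosets_subgroup_eq_image using ui by blast
    qed
    then have "finite D" using fin finite_surj by blast
    moreover have "D \<subseteq> V" unfolding D_def using Uc v action_closed by blast
    moreover have "\<forall>u\<in>U. \<forall>y\<in>D. \<pi> u y \<in> D"
    proof (intro ballI)
      fix u y assume u: "u \<in> U" and "y \<in> D"
      then obtain u' where u': "u' \<in> U" "y = \<pi> u' v" unfolding D_def by blast
      have "\<pi> u y = \<pi> (u \<otimes> u') v" using u u' Uc v by (simp add: action_mult subsetD)
      then show "\<pi> u y \<in> D" unfolding D_def using subgroup.m_closed[OF U(1) u u'(1)] by blast
    qed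
    moreover have "\<pi> n v - scl 1 v \<in> vs.span (?gen D)"
    proof (rule vs.span_base)
      have "v = \<pi> \<one> v" using v by (simp add: action_one)
      then have "v \<in> D" unfolding D_def using subgroup.one_closed[OF U(1)] by blast
      then show "\<pi> n v - scl 1 v \<in> ?gen D" using n by auto
    qed
    ultimately show "?P (\<pi> n v - scl 1 v)" by blast
  next
    show "?P 0" by (intro exI[of _ "{}"]) (simp add: vs.span_zero)
  next
    fix v w assume "?P v" "?P w"
    then obtain D D' where D: "finite D" "D \<subseteq> V" "\<forall>u\<in>U. \<forall>y\<in>D. \<pi> u y \<in> D" "v \<in> vs.span (?gen D)"
      and D': "finite D'" "D' \<subseteq> V" "\<forall>u\<in>U. \<forall>y\<in>D'. \<pi> u y \<in> D'" "w \<in> vs.span (?gen D')"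
      by (elim exE conjE) (rule that)
    have "vs.span (?gen D) \<subseteq> vs.span (?gen (D \<union> D'))" "vs.span (?gen D') \<subseteq> vs.span (?gen (D \<union> D'))"
      by (rule vs.span_mono, blast)+
    then have "v + w \<in> vs.span (?gen (D \<union> D'))" using D(4) D'(4) by (blast intro: vs.span_add)
    moreover have "\<forall>u\<in>U. \<forall>y\<in>D \<union> D'. \<pi> u y \<in> D \<union> D'" using D(3) D'(3) by blast
    ultimately show "?P (v + w)"
      using D(1,2) D'(1,2) by (intro exI[of _ "D \<union> D'"] conjI) simp_all
  next
    fix c v assume "?P v"
    then show "?P (scl c v)" by (blast intro: vs.span_scale)
  qed
qed

text \<open>
  On the span of a finite \<open>U\<close>-stable set \<open>D\<close> the group \<open>U\<close> acts through a finite quotient of order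
  invertible in the field. The sum \<open>E\<close> over this quotient kills the generators
  \<open>\<pi>(u) y - y\<close> with \<open>y \<in> D\<close>, and multiplies a fixed vector by the order.
\<close>

lemma fixed_vector_not_in_twisted_kernel:
  assumes U: "subgroup U G" "openin T U"
    and index: "\<And>S. \<lbrakk>subgroup S G; openin T S; S \<subseteq> U\<rbrakk> \<Longrightarrow>
      of_nat (card (rcosets\<^bsub>G\<lparr>carrier := U\<rparr>\<^esub> S)) \<noteq> (0::'r)"
    and v: "v \<in> V" and fixed: "\<And>u. u \<in> U \<Longrightarrow> \<pi> u v = v"
    and ker: "v \<in> twisted_kernel scl V \<pi> U (\<lambda>_. 1)"
  shows "v = 0"
proof -
  have Uc: "u \<in> carrier G" if "u \<in> U" for u using subgroup.mem_carrier[OF U(1) that] .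
  have "\<exists>D. finite D \<and> D \<subseteq> V \<and> (\<forall>u\<in>U. \<forall>y\<in>D. \<pi> u y \<in> D) \<and>
      v \<in> vs.span {\<pi> u y - y | u y. u \<in> U \<and> y \<in> D}"
    by (rule finite_stable_set_spanning[OF U _ ker]) (rule index)
  then obtain D where D: "finite D" "D \<subseteq> V" "\<forall>u\<in>U. \<forall>y\<in>D. \<pi> u y \<in> D"
    and vD: "v \<in> vs.span {\<pi> u y - y | u y. u \<in> U \<and> y \<in> D}"
    by (elim exE conjE) (rule that)
  \<comment> \<open>Since \<open>D\<close> is stable, \<open>S\<close> also fixes all \<open>\<pi>(a) y\<close>, so that \<open>\<pi>(a) y\<close> depends only on the
    coset \<open>S a\<close>.\<close>
  define S where "S = {u \<in> U. \<forall>y\<in>D. \<pi> u y = y}"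
  have S: "subgroup S G" "openin T S" "S \<subseteq> U"
    unfolding S_def using subgroup_pointwise_stabilizer[OF U(1) D(2)]
      openin_pointwise_stabilizer[OF U(2) D(1,2)] by auto
  let ?R = "rcosets\<^bsub>G\<lparr>carrier := U\<rparr>\<^esub> S"
  define E where "E y = coset_sum G U S (\<lambda>a. \<pi> a y)" for y
  have rep: "(SOME a. a \<in> C) \<in> U" if C: "C \<in> ?R" for C
  proof -
    obtain a where a: "a \<in> U" "C = S #> a" using C unfolding rcosets_subgroup_eq_image by blast
    obtain s where "s \<in> S" "(SOME b. b \<in> S #> a) = s \<otimes> a"
      using coset_representative[OF S(1) U(1) S(3) a(1)] .
    then show ?thesis using a S(3) subgroup.m_closed[OF U(1)] by auto
  qed
  have E_add: "E (x + y) = E x + E y" if "x \<in> V" "y \<in> V" for x y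
    unfolding E_def coset_sum_def sum.distrib[symmetric]
    using that by (intro sum.cong refl action_add Uc rep)
  have E_diff: "E (x - y) = E x - E y" if "x \<in> V" "y \<in> V" for x y
    unfolding E_def coset_sum_def sum_subtractf[symmetric]
    using that by (intro sum.cong refl action_diff Uc rep)
  have E_scale: "E (scl c x) = scl c (E x)" if "x \<in> V" for c x
    unfolding E_def coset_sum_def vs.scale_sum_right
    using that by (intro sum.cong refl action_scale Uc rep)
  have E_gen: "E (\<pi> u y - y) = 0" if u: "u \<in> U" and y: "y \<in> D" for u y
  proof -
    have yV: "y \<in> V" using y D by blast
    have inv: "\<pi> (s \<otimes> a) y = \<pi> a y" if "s \<in> S" "a \<in> U" for s a
    proof -
      have "\<pi> a y \<in> D" using D(3) that y by blast
      then have "\<pi> s (\<pi> a y) = \<pi> a y" using that by (simp add: S_def)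
      then show ?thesis using that S(3) Uc yV by (simp add: action_mult subsetD)
    qed
    have "E (\<pi> u y) = coset_sum G U S (\<lambda>a. \<pi> (a \<otimes> u) y)"
      unfolding E_def coset_sum_def
      by (intro sum.cong refl action_mult[symmetric] Uc rep u yV)
    also have "\<dots> = E y"
      unfolding E_def by (rule coset_sum_translate[OF S(1) U(1) S(3) inv u])
    finally show ?thesis using E_diff[of "\<pi> u y" y] yV u Uc action_closed by simp
  qed
  have "vs.span {\<pi> u y - y | u y. u \<in> U \<and> y \<in> D} \<subseteq> {x \<in> V. E x = 0}"
  proof (rule vs.span_minimal)
    show "{\<pi> u y - y | u y. u \<in> U \<and> y \<in> D} \<subseteq> {x \<in> V. E x = 0}"
      using D(2) Uc by (auto simp: E_gen intro!: V_diff action_closed)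
    have "E 0 = 0" using E_scale[of 0 0] V_zero by simp
    then show "vs.subspace {x \<in> V. E x = 0}"
      by (intro vs.subspaceI) (auto simp: V_zero V_add V_scale E_add E_scale)
  qed
  then have "E v = 0" using vD by blast
  moreover have "E v = (\<Sum>C\<in>?R. v)"
    unfolding E_def coset_sum_def using fixed rep by (intro sum.cong refl) simp
  ultimately have "scl (of_nat (card ?R)) v = 0" by (simp add: vs.sum_constant_scale)
  then show "v = 0" using index[OF S] by simp
qed

text \<open>
  Let \<open>U\<close> be the stabilizer of \<open>v\<close> in \<open>K\<close>. Its open subgroups have invertible index in it, so \<open>v\<close>
  survives in the coinvariants of \<open>U\<close>; a form on these coinvariants that is nonzero at \<open>v\<close> is
  \<open>U\<close>-invariant, hence smooth.
\<close>

lemma exists_smooth_form: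
  assumes K: "compact_open_subgroup_invertible_pro_order TYPE('r) G T K"
    and v: "v \<in> V" "v \<noteq> 0"
  obtains f where "f \<in> smooth_dual G T scl V \<pi>" "f v = 1"
proof -
  have K': "subgroup K G" "openin T K"
    and inv: "invertible_pro_order TYPE('r) (G\<lparr>carrier := K\<rparr>) (subtopology T K)"
    using K unfolding compact_open_subgroup_invertible_pro_order_def by auto
  define U where "U = {u \<in> K. \<forall>y\<in>{v}. \<pi> u y = y}"
  have U: "subgroup U G" "openin T U" "U \<subseteq> K"
    unfolding U_def using subgroup_pointwise_stabilizer[OF K'(1), of "{v}"]
      openin_pointwise_stabilizer[OF K'(2), of "{v}"] v by auto
  have Uc: "u \<in> carrier G" if "u \<in> U" for u using subgroup.mem_carrier[OF U(1) that] .
  have index: "of_nat (card (rcosets\<^bsub>G\<lparr>carrier := U\<rparr>\<^esub> S)) \<noteq> (0::'r)"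
    if S: "subgroup S G" "openin T S" "S \<subseteq> U" for S
  proof -
    have "S \<subseteq> K" using S U by blast
    moreover have "openin (subtopology T K) S"
      using S(2) \<open>S \<subseteq> K\<close> by (metis inf.absorb_iff2 openin_subtopology_Int2)
    ultimately have "(of_nat (card (rcosets\<^bsub>G\<lparr>carrier := K\<rparr>\<^esub> S)) :: 'r) dvd 1"
      using inv subgroup_incl[OF S(1) K'(1)] unfolding invertible_pro_order_def by blast
    then show ?thesis unfolding card_rcosets_trans[OF S(1) U(1) S(3) K'(1) U(3)] by auto
  qed
  have fixed: "\<pi> u v = v" if "u \<in> U" for u using that by (simp add: U_def)
  have notin: "v \<notin> twisted_kernel scl V \<pi> U (\<lambda>_. 1)"
  proof
    assume ker: "v \<in> twisted_kernel scl V \<pi> U (\<lambda>_. 1)"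
    have "v = 0"
      by (rule fixed_vector_not_in_twisted_kernel[OF U(1,2) _ v(1) _ ker]) (rule index fixed; assumption)+
    then show False using v(2) by contradiction
  qed
  obtain f where f: "f \<in> linear_forms scl V" "f v = 1"
    and ker: "\<And>k. k \<in> twisted_kernel scl V \<pi> U (\<lambda>_. 1) \<Longrightarrow> f k = 0"
    by (rule separating_form_on_subspace[OF subspace_twisted_kernel v(1) notin]) (rule that)
  have "f \<in> smooth_dual G T scl V \<pi>"
  proof (rule smooth_dualI[OF f(1) U(2)])
    show "\<one> \<in> U" using subgroup.one_closed[OF U(1)] .
    fix u assume u: "u \<in> U"
    have ui: "inv u \<in> U" using subgroup.m_inv_closed[OF U(1) u] .
    have "f (\<pi> (inv u) x) = f x" if x: "x \<in> V" for x
    proof -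
      have "\<pi> (inv u) x - scl 1 x \<in> twisted_kernel scl V \<pi> U (\<lambda>_. 1)"
        by (rule twisted_kernel_generator[OF ui x])
      then have "f (\<pi> (inv u) x - x) = 0" using ker by simp
      then show ?thesis using form_diff[OF f(1)] x ui Uc action_closed by simp
    qed
    then show "contragredient_action G V \<pi> u f = f"
      by (auto simp: contragredient_action_def form_outside[OF f(1)])
  qed
  then show thesis using that f(2) by blast
qed

text \<open>
  A compact set is covered by finitely many left cosets of the open stabilizer of \<open>w\<close>.
\<close>

lemma finite_translates_mod_center:
  assumes C: "compactin T C" and w: "w \<in> V"
  obtains Q where "finite Q" "Q \<subseteq> carrier G"
    "\<And>g. g \<in> C <#> group_center G \<Longrightarrow> \<exists>q\<in>Q. \<exists>z\<in>group_center G. \<pi> g w = \<pi> z (\<pi> q w)"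
proof -
  have Cc: "C \<subseteq> carrier G" using compactin_subset_topspace[OF C] topspace_eq by simp
  let ?U = "{g \<in> carrier G. \<pi> g w = w}"
  have "\<one> \<in> ?U" using w by (simp add: action_one)
  then obtain Q where Q: "finite Q" "Q \<subseteq> C" "C \<subseteq> (\<Union>q\<in>Q. q <# ?U)"
    using compact_covered_by_left_cosets[OF C open_stabilizer[OF w]] by metis
  have "\<exists>q\<in>Q. \<exists>z\<in>group_center G. \<pi> g w = \<pi> z (\<pi> q w)" if g: "g \<in> C <#> group_center G" for g
  proof -
    obtain c z where cz: "c \<in> C" "z \<in> group_center G" "g = c \<otimes> z"
      using g unfolding set_mult_def by blast
    then obtain q where q: "q \<in> Q" "c \<in> q <# ?U" using Q(3) by blast
    then obtain u where u: "u \<in> carrier G" "\<pi> u w = w" "c = q \<otimes> u" unfolding l_coset_def by blast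
    have mem: "c \<in> carrier G" "q \<in> carrier G" "z \<in> carrier G"
      using cz q Q(2) Cc group_center_closed by auto
    have "g = z \<otimes> c" using cz group_center_commute[OF cz(2) mem(1)] by simp
    then have "\<pi> g w = \<pi> z (\<pi> q w)" using mem u w by (simp add: action_mult action_closed)
    then show ?thesis using q cz by blast
  qed
  then show thesis using that[OF Q(1)] Q(2) Cc by blast
qed

lemma contragredient_pairing:
  "invariant_pairing G scl V \<pi> fun_scale (smooth_dual G T scl V \<pi>) (contragredient_action G V \<pi>)
    (\<lambda>v f. f v)"
proof -
  interpret D: smooth_representation G T fun_scale "smooth_dual G T scl V \<pi>" "contragredient_action G V \<pi>"
    by (rule smooth_representation_contragredient)
  show ?thesis
    by unfold_locales
      (auto simp: linear_form_of_smooth_dual form_add form_scale fun_scale_def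
        contragredient_action_def action_closed action_inv_cancel)
qed

end

section \<open>Central operators and eigenvalues\<close>

text \<open>
  Up to a nonzero scalar, \<open>p(T)\<close> is a product of operators \<open>T - a\<close>, each of which is injective
  modulo \<open>K\<close>.
\<close>

lemma poly_operator_injective_mod:
  fixes scl :: "'r::alg_closed_field \<Rightarrow> 'v::ab_group_add \<Rightarrow> 'v"
  assumes vs: "vector_space scl" and V: "module.subspace scl V"
    and T: "\<And>v. v \<in> V \<Longrightarrow> T v \<in> V"
      "\<And>v w. \<lbrakk>v \<in> V; w \<in> V\<rbrakk> \<Longrightarrow> T (v + w) = T v + T w"
      "\<And>c v. v \<in> V \<Longrightarrow> T (scl c v) = scl c (T v)"
    and K: "module.subspace scl K"
    and inj: "\<And>a v. \<lbrakk>v \<in> V; T v - scl a v \<in> K\<rbrakk> \<Longrightarrow> v \<in> K"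
    and p: "p \<noteq> 0" and u: "u \<in> V"
    and "(\<Sum>k\<le>degree p. scl (coeff p k) ((T ^^ k) u)) \<in> K"
  shows "u \<in> K"
  using p assms(10)
proof (induction "degree p" arbitrary: p)
  case 0
  interpret vs: vector_space scl by (rule vs)
  have c: "coeff p 0 \<noteq> 0" using 0 by (metis leading_coeff_0_iff)
  have "scl (coeff p 0) u \<in> K" using 0 by simp
  then have "scl (inverse (coeff p 0)) (scl (coeff p 0) u) \<in> K" by (rule vs.subspace_scale[OF K])
  then show ?case using c by simp
next
  case (Suc d)
  interpret vs: vector_space scl by (rule vs)
  obtain a where "poly p a = 0"
    using alg_closed_imp_poly_has_root[of p] Suc.hyps(2) by auto
  then obtain q where q: "p = [:-a, 1:] * q" using poly_eq_0_iff_dvd by (metis dvdE)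
  have q0: "q \<noteq> 0" using q Suc.prems(1) by auto
  have dp: "degree p = Suc (degree q)" unfolding q using q0 by (subst degree_mult_eq) auto
  then have dq: "d = degree q" using Suc.hyps(2) by simp
  have pow: "(T ^^ k) u \<in> V" for k by (induction k) (use u T(1) in auto)
  define y where "y = (\<Sum>k\<le>d. scl (coeff q k) ((T ^^ k) u))"
  have sumV: "(\<Sum>k\<in>A. scl (c k) ((T ^^ f k) u)) \<in> V" for A :: "nat set" and c f
    by (intro vs.subspace_sum[OF V] vs.subspace_scale[OF V] pow)
  have yV: "y \<in> V" unfolding y_def by (rule sumV[where f = "\<lambda>k. k"])
  have Tsum: "T (\<Sum>k\<in>A. scl (c k) ((T ^^ k) u)) = (\<Sum>k\<in>A. scl (c k) ((T ^^ Suc k) u))"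
    if "finite A" for A :: "nat set" and c
    using that
  proof (induction A rule: finite_induct)
    case empty
    have "T (scl 0 0) = scl 0 (T 0)" by (rule T(3)[OF vs.subspace_0[OF V]])
    then show ?case by simp
  next
    case (insert k A)
    have "T (scl (c k) ((T ^^ k) u) + (\<Sum>k\<in>A. scl (c k) ((T ^^ k) u)))
        = T (scl (c k) ((T ^^ k) u)) + T (\<Sum>k\<in>A. scl (c k) ((T ^^ k) u))"
      by (rule T(2)[OF vs.subspace_scale[OF V pow] sumV[where f = "\<lambda>k. k"]])
    then show ?case using insert by (simp add: T(3)[OF pow])
  qed
  have coeff: "coeff p 0 = - a * coeff q 0" "coeff p (Suc k) = coeff q k - a * coeff q (Suc k)" for k
    by (simp_all add: q)
  have "(\<Sum>k\<le>degree p. scl (coeff p k) ((T ^^ k) u))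
      = scl (coeff p 0) u + (\<Sum>k\<le>d. scl (coeff p (Suc k)) ((T ^^ Suc k) u))"
    unfolding Suc.hyps(2)[symmetric] by (subst sum.atMost_Suc_shift) simp
  also have "\<dots> = (\<Sum>k\<le>d. scl (coeff q k) ((T ^^ Suc k) u)) -
      (scl (a * coeff q 0) u + (\<Sum>k\<le>d. scl (a * coeff q (Suc k)) ((T ^^ Suc k) u)))"
    by (simp add: coeff vs.scale_left_diff_distrib sum_subtractf algebra_simps del: funpow.simps)
  also have "scl (a * coeff q 0) u + (\<Sum>k\<le>d. scl (a * coeff q (Suc k)) ((T ^^ Suc k) u))
      = (\<Sum>k\<le>Suc d. scl (a * coeff q k) ((T ^^ k) u))"
    by (subst sum.atMost_Suc_shift) simp
  also have "\<dots> = scl a y"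
    using coeff_eq_0[of q "Suc d"] dq by (simp add: y_def vs.scale_sum_right)
  also have "(\<Sum>k\<le>d. scl (coeff q k) ((T ^^ Suc k) u)) = T y"
    unfolding y_def by (rule Tsum[symmetric]) simp
  finally have "T y - scl a y \<in> K" using Suc.prems(2) by simp
  then have "y \<in> K" by (rule inj[OF yV])
  then show ?case using Suc.hyps(1)[OF dq q0] unfolding y_def dq by blast
qed

text \<open>
  For a nonzero \<open>u\<close> in \<open>V / K\<close>, a linear relation among \<open>u, T u, T\<^sup>2 u, \<dots>\<close> would be of the form
  \<open>p(T) u = 0\<close> with \<open>p \<noteq> 0\<close>, whereas \<open>p(T)\<close> is injective modulo \<open>K\<close>.
\<close>

lemma codim_infinite_if_no_eigenvalue:
  fixes scl :: "'r::alg_closed_field \<Rightarrow> 'v::ab_group_add \<Rightarrow> 'v"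
  assumes vs: "vector_space scl" and V: "module.subspace scl V"
    and T: "\<And>v. v \<in> V \<Longrightarrow> T v \<in> V"
      "\<And>v w. \<lbrakk>v \<in> V; w \<in> V\<rbrakk> \<Longrightarrow> T (v + w) = T v + T w"
      "\<And>c v. v \<in> V \<Longrightarrow> T (scl c v) = scl c (T v)"
    and K: "module.subspace scl K"
    and inj: "\<And>a v. \<lbrakk>v \<in> V; T v - scl a v \<in> K\<rbrakk> \<Longrightarrow> v \<in> K"
    and one: "codim_at_least scl V K 1"
  shows "codim_at_least scl V K r"
proof -
  interpret vs: vector_space scl by (rule vs)
  obtain u where u: "u \<in> V" "u \<notin> K" using one vs.codim_at_least_one_iff[OF K] by blast
  have pow: "(T ^^ k) u \<in> V" for k by (induction k) (use u T(1) in auto)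
  have "indep_mod scl K {..<r} (\<lambda>k. (T ^^ k) u)"
    unfolding indep_mod_def
  proof (intro allI impI, rule ccontr)
    fix c :: "nat \<Rightarrow> 'r" assume c: "(\<Sum>i<r. scl (c i) ((T ^^ i) u)) \<in> K" and "\<not> (\<forall>i\<in>{..<r}. c i = 0)"
    then obtain i where i: "i < r" "c i \<noteq> 0" by auto
    define p where "p = (\<Sum>k<r. monom (c k) k)"
    have coeff: "coeff p k = (if k < r then c k else 0)" for k
      by (simp add: p_def coeff_sum sum.delta)
    have "p \<noteq> 0" using coeff[of i] i by auto
    have "degree p < r"
      using coeff[of "degree p"] \<open>p \<noteq> 0\<close> by (metis leading_coeff_0_iff)
    then have "(\<Sum>k\<le>degree p. scl (coeff p k) ((T ^^ k) u)) = (\<Sum>k<r. scl (coeff p k) ((T ^^ k) u))"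
      by (intro sum.mono_neutral_left) (auto simp: coeff_eq_0)
    also have "\<dots> = (\<Sum>k<r. scl (c k) ((T ^^ k) u))" by (intro sum.cong) (auto simp: coeff)
    finally have *: "(\<Sum>k\<le>degree p. scl (coeff p k) ((T ^^ k) u)) \<in> K" using c by simp
    have "u \<in> K"
      by (rule poly_operator_injective_mod[OF vs V _ _ _ K _ \<open>p \<noteq> 0\<close> u(1) *])
        (rule T inj; assumption)+
    then show False using u(2) by contradiction
  qed
  then show ?thesis
    unfolding codim_at_least_def by (intro exI[of _ "\<lambda>k. (T ^^ k) u"]) (simp add: pow)
qed

context irreducible_smooth_representation
begin

text \<open>
  Schur's lemma: \<open>\<pi>(z) - a\<close> is an endomorphism of \<open>\<pi>\<close> different from \<open>0\<close>, so its kernel is zero and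
  its image is \<open>V\<close>. The map \<open>S\<close> is its inverse.
\<close>

lemma central_element_minus_scalar_invertible:
  assumes z: "z \<in> group_center G" and nonscalar: "\<not> (\<exists>c. \<forall>v\<in>V. \<pi> z v = scl c v)"
  shows "\<exists>S. (\<forall>v\<in>V. S v \<in> V) \<and> (\<forall>v\<in>V. \<forall>w\<in>V. S (v + w) = S v + S w) \<and>
    (\<forall>c. \<forall>v\<in>V. S (scl c v) = scl c (S v)) \<and>
    (\<forall>g\<in>carrier G. \<forall>v\<in>V. S (\<pi> g v) = \<pi> g (S v)) \<and>
    (\<forall>v\<in>V. S (\<pi> z v - scl a v) = v) \<and> (\<forall>v\<in>V. \<pi> z (S v) - scl a (S v) = v)"
proof -
  have zc: "z \<in> carrier G" using group_center_closed[OF z] .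
  define L where "L v = \<pi> z v - scl a v" for v
  have LV: "L v \<in> V" if "v \<in> V" for v
    unfolding L_def using that zc by (intro V_diff V_scale action_closed)
  have L_add: "L (v + w) = L v + L w" if "v \<in> V" "w \<in> V" for v w
    using that zc by (simp add: L_def action_add vs.scale_right_distrib)
  have L_scale: "L (scl c v) = scl c (L v)" if "v \<in> V" for c v
    using that zc by (simp add: L_def action_scale vs.scale_right_diff_distrib mult.commute)
  have L_act: "L (\<pi> g v) = \<pi> g (L v)" if "g \<in> carrier G" "v \<in> V" for g v
    using that zc by (simp add: L_def action_diff action_closed V_scale action_scale
        center_action_commute[OF z])
  have L_zero: "L 0 = 0" using zc by (simp add: L_def action_zero)
  have "{v \<in> V. L v = 0} = {0} \<or> {v \<in> V. L v = 0} = V"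
  proof (rule irreducible)
    show "vs.subspace {v \<in> V. L v = 0}"
      by (rule vs.subspaceI) (auto simp: V_zero V_add V_scale L_zero L_add L_scale)
  qed (auto simp: action_closed L_act action_zero)
  moreover have nonzero: "\<exists>v\<in>V. L v \<noteq> 0"
    using nonscalar by (auto simp: L_def)
  ultimately have ker: "{v \<in> V. L v = 0} = {0}" by blast
  have "L ` V = {0} \<or> L ` V = V"
  proof (rule irreducible)
    show "vs.subspace (L ` V)"
    proof (rule vs.subspaceI)
      show "0 \<in> L ` V" using L_zero V_zero by force
      show "\<And>x y. \<lbrakk>x \<in> L ` V; y \<in> L ` V\<rbrakk> \<Longrightarrow> x + y \<in> L ` V"
        by (auto simp: L_add[symmetric] V_add)
      show "\<And>c x. x \<in> L ` V \<Longrightarrow> scl c x \<in> L ` V"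
        by (auto simp: L_scale[symmetric] V_scale)
    qed
    show "L ` V \<subseteq> V" using LV by blast
    show "\<And>g w. \<lbrakk>g \<in> carrier G; w \<in> L ` V\<rbrakk> \<Longrightarrow> \<pi> g w \<in> L ` V"
      by (auto simp: L_act[symmetric] action_closed)
  qed
  then have surj: "L ` V = V" using nonzero by auto
  have L_diff: "L (v - w) = L v - L w" if "v \<in> V" "w \<in> V" for v w
    using L_add[of "v - w" w] that V_diff by (simp add: eq_diff_eq)
  have inj: "inj_on L V"
  proof (rule inj_onI)
    fix v w assume vw: "v \<in> V" "w \<in> V" "L v = L w"
    then have "v - w \<in> {v \<in> V. L v = 0}" by (simp add: V_diff L_diff)
    then show "v = w" unfolding ker by simp
  qed
  define S where "S = inv_into V L"
  have SV: "S v \<in> V" if "v \<in> V" for v unfolding S_def using inv_into_into[of v L V] that surj by simp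
  have LS: "L (S v) = v" if "v \<in> V" for v unfolding S_def using f_inv_into_f[of v L V] that surj by simp
  have SL: "S (L v) = v" if "v \<in> V" for v unfolding S_def using inv_into_f_f[OF inj that] .
  have S_add: "S (v + w) = S v + S w" if "v \<in> V" "w \<in> V" for v w
  proof -
    have "v + w = L (S v + S w)" using that by (simp add: L_add SV LS)
    then show ?thesis using that by (simp add: SL SV V_add)
  qed
  have S_scale: "S (scl c v) = scl c (S v)" if "v \<in> V" for c v
  proof -
    have "scl c v = L (scl c (S v))" using that by (simp add: L_scale SV LS)
    then show ?thesis using that by (simp add: SL SV V_scale)
  qed
  have S_act: "S (\<pi> g v) = \<pi> g (S v)" if "g \<in> carrier G" "v \<in> V" for g v
  proof -
    have "\<pi> g v = L (\<pi> g (S v))" using that by (simp add: L_act SV LS)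
    then show ?thesis using that by (simp add: SL SV action_closed)
  qed
  show ?thesis
    by (rule exI[of _ S])
      (use SV S_add S_scale S_act SL LS in \<open>simp add: L_def\<close>)
qed

lemma central_scalar_inv:
  assumes z: "z \<in> group_center G" and c: "\<forall>v\<in>V. \<pi> (inv z) v = scl c v"
  shows "\<exists>c. \<forall>v\<in>V. \<pi> z v = scl c v"
proof -
  have zc: "z \<in> carrier G" using group_center_closed[OF z] .
  have eq: "v = scl c (\<pi> z v)" if "v \<in> V" for v
  proof -
    have "v = \<pi> z (\<pi> (inv z) v)" using action_inv_cancel'[OF zc that] by simp
    also have "\<dots> = \<pi> z (scl c v)" using c that by simp
    finally show ?thesis using action_scale[OF zc that] by simp
  qed
  obtain v0 where "v0 \<in> V" "v0 \<noteq> 0" using nonzero V_zero by blast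
  then have "c \<noteq> 0" using eq[of v0] by auto
  have "\<pi> z v = scl (inverse c) v" if v: "v \<in> V" for v
  proof -
    have "scl (inverse c) v = scl (inverse c) (scl c (\<pi> z v))"
      using eq[OF v] by (rule arg_cong)
    then show ?thesis using \<open>c \<noteq> 0\<close> by simp
  qed
  then show ?thesis by blast
qed

text \<open>
  The inverse of \<open>\<pi>(z) - a\<close> preserves the twisted kernel.
\<close>

lemma central_minus_scalar_reflects_twisted_kernel:
  assumes N: "N \<subseteq> carrier G" and z: "z \<in> group_center G"
    and nonscalar: "\<not> (\<exists>c. \<forall>v\<in>V. \<pi> z v = scl c v)"
    and v: "v \<in> V" "\<pi> z v - scl a v \<in> twisted_kernel scl V \<pi> N \<theta>"
  shows "v \<in> twisted_kernel scl V \<pi> N \<theta>"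
proof -
  obtain S where S: "\<forall>v\<in>V. S v \<in> V" "\<forall>v\<in>V. \<forall>w\<in>V. S (v + w) = S v + S w"
    "\<forall>c. \<forall>v\<in>V. S (scl c v) = scl c (S v)" "\<forall>g\<in>carrier G. \<forall>v\<in>V. S (\<pi> g v) = \<pi> g (S v)"
    "\<forall>v\<in>V. S (\<pi> z v - scl a v) = v"
    using central_element_minus_scalar_invertible[OF z nonscalar, of a]
    by (elim exE conjE) (rule that)
  have "S (\<pi> z v - scl a v) \<in> twisted_kernel scl V \<pi> N \<theta>"
    by (rule twisted_kernel_intertwiner[OF N _ _ _ _ v(2)]) (use S N in auto)
  then show ?thesis using S(5) v(1) by simp
qed

text \<open>
  On the contragredient \<open>z\<close> acts by the transpose of \<open>\<pi>(z\<^sup>-\<^sup>1)\<close>, so \<open>z - a\<close> has as inverse the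
  transpose \<open>L\<close> of the inverse \<open>S\<close> of \<open>\<pi>(z\<^sup>-\<^sup>1) - a\<close>. Since \<open>S\<close> commutes with \<open>G\<close>, so does \<open>L\<close>, which
  therefore preserves smoothness and the twisted kernel.
\<close>

lemma central_minus_scalar_reflects_contragredient_twisted_kernel:
  fixes f :: "'d \<Rightarrow> 'c"
  assumes N: "N \<subseteq> carrier G" and z: "z \<in> group_center G"
    and nonscalar: "\<not> (\<exists>c. \<forall>v\<in>V. \<pi> z v = scl c v)"
    and f: "f \<in> smooth_dual G T scl V \<pi>"
      "contragredient_action G V \<pi> z f - fun_scale a f
        \<in> twisted_kernel fun_scale (smooth_dual G T scl V \<pi>) (contragredient_action G V \<pi>) N \<theta>"
  shows "f \<in> twisted_kernel fun_scale (smooth_dual G T scl V \<pi>) (contragredient_action G V \<pi>) N \<theta>"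
proof -
  interpret D: smooth_representation G T fun_scale "smooth_dual G T scl V \<pi>" "contragredient_action G V \<pi>"
    by (rule smooth_representation_contragredient)
  have zi: "inv z \<in> group_center G" "inv z \<in> carrier G"
    using group_center_inv[OF z] group_center_closed by auto
  have ns: "\<not> (\<exists>c. \<forall>v\<in>V. \<pi> (inv z) v = scl c v)"
    using central_scalar_inv[OF z] nonscalar by blast
  obtain S where S: "\<forall>v\<in>V. S v \<in> V" "\<forall>v\<in>V. \<forall>w\<in>V. S (v + w) = S v + S w"
    "\<forall>c. \<forall>v\<in>V. S (scl c v) = scl c (S v)" "\<forall>g\<in>carrier G. \<forall>v\<in>V. S (\<pi> g v) = \<pi> g (S v)"
    "\<forall>v\<in>V. \<pi> (inv z) (S v) - scl a (S v) = v"
    using central_element_minus_scalar_invertible[OF zi(1) ns, of a]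
    by (elim exE conjE) (rule that)
  define L where "L h = (\<lambda>v. if v \<in> V then h (S v) else 0)" for h :: "'d \<Rightarrow> 'c"
  have L_act: "L (contragredient_action G V \<pi> g h) = contragredient_action G V \<pi> g (L h)"
    if "g \<in> carrier G" for g h
    using that S by (auto simp: L_def contragredient_action_def action_closed fun_eq_iff)
  have L_form: "L h \<in> linear_forms scl V" if "h \<in> linear_forms scl V" for h
    using that S by (auto simp: L_def linear_forms_def V_add V_scale)
  have L_closed: "L h \<in> smooth_dual G T scl V \<pi>" if h: "h \<in> smooth_dual G T scl V \<pi>" for h
  proof (rule smooth_dualI[OF L_form openin_contragredient_stabilizer[OF h]])
    show "h \<in> linear_forms scl V" using linear_form_of_smooth_dual[OF h] .
    then show "\<one> \<in> {g \<in> carrier G. contragredient_action G V \<pi> g h = h}"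
      by (simp add: contragredient_one)
    fix u assume "u \<in> {g \<in> carrier G. contragredient_action G V \<pi> g h = h}"
    then show "contragredient_action G V \<pi> u (L h) = L h" using L_act[of u h] by simp
  qed
  have "L (contragredient_action G V \<pi> z f - fun_scale a f)
    \<in> twisted_kernel fun_scale (smooth_dual G T scl V \<pi>) (contragredient_action G V \<pi>) N \<theta>"
  proof (rule D.twisted_kernel_intertwiner[OF N L_closed _ _ L_act f(2)])
    show "\<And>n. n \<in> N \<Longrightarrow> n \<in> carrier G" using N by blast
  qed (auto simp: L_def fun_scale_def fun_eq_iff)
  also have "L (contragredient_action G V \<pi> z f - fun_scale a f) = f"
  proof
    fix v
    have lf: "f \<in> linear_forms scl V" using linear_form_of_smooth_dual[OF f(1)] .
    show "L (contragredient_action G V \<pi> z f - fun_scale a f) v = f v"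
    proof (cases "v \<in> V")
      case True
      then have Sv: "S v \<in> V" using S(1) by blast
      have "f (\<pi> (inv z) (S v) - scl a (S v)) = f (\<pi> (inv z) (S v)) - a * f (S v)"
        using Sv zi by (simp add: form_diff[OF lf] form_scale[OF lf] action_closed V_scale)
      then show ?thesis
        using True Sv S(5) by (simp add: L_def contragredient_action_def fun_scale_def)
    next
      case False
      then show ?thesis by (simp add: L_def form_outside[OF lf])
    qed
  qed
  finally show ?thesis .
qed

end

section \<open>Multiplicities in the contragredient\<close>

context irreducible_smooth_representation
begin

text \<open>
  The vectors all of whose translates are killed by \<open>f\<close> form a subrepresentation.
\<close>

lemma coefficient_nondegenerate:
  assumes f: "f \<in> linear_forms scl V" and v: "v \<in> V"
    and zero: "\<And>g. g \<in> carrier G \<Longrightarrow> f (\<pi> g v) = 0"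
  shows "f = 0 \<or> v = 0"
proof -
  let ?X = "{x \<in> V. \<forall>g\<in>carrier G. f (\<pi> g x) = 0}"
  have "?X = {0} \<or> ?X = V"
  proof (rule irreducible)
    show "vs.subspace ?X"
      by (rule vs.subspaceI)
        (auto simp: V_zero V_add V_scale action_zero action_add action_scale action_closed
          form_zero form_add form_scale f)
    fix g w assume "g \<in> carrier G" "w \<in> ?X"
    then show "\<pi> g w \<in> ?X" by (auto simp: action_closed action_mult[symmetric])
  qed blast
  then show ?thesis
  proof
    assume "?X = {0}"
    moreover have "v \<in> ?X" using v zero by blast
    ultimately show ?thesis by blast
  next
    assume X: "?X = V"
    have "f x = 0" for x
    proof (cases "x \<in> V")
      case True
      then have "\<forall>g\<in>carrier G. f (\<pi> g x) = 0" using X by blast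
      then show ?thesis using action_one[OF True] by force
    qed (rule form_outside[OF f])
    then show ?thesis by auto
  qed
qed

text \<open>
  The transfer for the evaluation pairing \<open>(v, f) \<mapsto> f(v)\<close>. The coefficient of \<open>v\<close> and \<open>f0\<close> at \<open>g\<close> is
  \<open>f0(\<pi>(g\<^sup>-\<^sup>1) v)\<close>, so the compact set that supports it is the inverse of the one supplied by
  \<open>Z\<close>-compactness.
\<close>

lemma codim_transfer_to_contragredient:
  fixes \<theta> :: "'a \<Rightarrow> 'c"
  assumes N: "subgroup N G"
    and exh: "exhausted_by_invertible_pro_order TYPE('c) (G\<lparr>carrier := N\<rparr>) (subtopology T N)"
    and \<theta>: "smooth_character (G\<lparr>carrier := N\<rparr>) (subtopology T N) \<theta>"
    and Zc: "Z_compact G T scl V \<pi>"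
    and f0: "f0 \<in> smooth_dual G T scl V \<pi>" "f0 \<noteq> 0"
    and scalar: "(\<forall>z\<in>group_center G. \<exists>c. \<forall>f\<in>smooth_dual G T scl V \<pi>.
        contragredient_action G V \<pi> z f = fun_scale c f) \<or> r \<le> 1"
    and codim: "codim_at_least scl V (twisted_kernel scl V \<pi> N \<theta>) r"
  shows "codim_at_least fun_scale (smooth_dual G T scl V \<pi>)
    (twisted_kernel fun_scale (smooth_dual G T scl V \<pi>) (contragredient_action G V \<pi>) N
      (\<lambda>n. inverse (\<theta> n))) r"
proof -
  interpret D: smooth_representation G T fun_scale "smooth_dual G T scl V \<pi>" "contragredient_action G V \<pi>"
    by (rule smooth_representation_contragredient)
  have lf0: "f0 \<in> linear_forms scl V" using linear_form_of_smooth_dual[OF f0(1)] .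
  show ?thesis
  proof (rule invariant_pairing.codim_twisted_kernel_transfer[OF contragredient_pairing N _ _ f0(1) _ _
        scalar codim])
    show "\<And>n. n \<in> N \<Longrightarrow> inverse (\<theta> n) = \<theta> (inv n)"
      using smooth_character_inv[OF N \<theta>] by simp
    show "\<exists>M. F \<subseteq> M \<and> M \<subseteq> N \<and> subgroup M G \<and>
      (\<forall>v\<in>V. \<exists>x. x \<in> vs.span ((\<lambda>m. \<pi> m v) ` M) \<and> (\<forall>n\<in>M. \<pi> n x = scl (\<theta> n) x) \<and>
        v - x \<in> twisted_kernel scl V \<pi> M \<theta>)" if "finite F" "F \<subseteq> N" for F
      using exists_average_of_exhausted[OF N exh \<theta> that] .
    show "x = 0" if x: "x \<in> V" and zero: "\<And>g. g \<in> carrier G \<Longrightarrow> contragredient_action G V \<pi> g f0 x = 0" for x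
    proof -
      have "f0 (\<pi> g x) = 0" if "g \<in> carrier G" for g
        using zero[of "inv g"] that x by (simp add: contragredient_action_def)
      then show ?thesis using coefficient_nondegenerate[OF lf0 x] f0(2) by blast
    qed
    fix v assume v: "v \<in> V"
    obtain C where C: "compactin T C" "{g \<in> carrier G. f0 (\<pi> g v) \<noteq> 0} \<subseteq> C <#> group_center G"
      using Zc v f0(1) unfolding Z_compact_def by blast
    have Cc: "C \<subseteq> carrier G" using compactin_subset_topspace[OF C(1)] topspace_eq by simp
    have "compactin T ((\<lambda>x. inv x) ` C)" by (rule image_compactin[OF C(1) continuous_inv])
    then obtain Q where Q: "finite Q" "Q \<subseteq> carrier G"
      and cover: "\<And>g. g \<in> ((\<lambda>x. inv x) ` C) <#> group_center G \<Longrightarrow>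
        \<exists>q\<in>Q. \<exists>z\<in>group_center G. contragredient_action G V \<pi> g f0 =
          contragredient_action G V \<pi> z (contragredient_action G V \<pi> q f0)"
      by (rule D.finite_translates_mod_center[OF _ f0(1)]) (rule that)
    have "g \<in> ((\<lambda>x. inv x) ` C) <#> group_center G"
      if g: "g \<in> carrier G" "contragredient_action G V \<pi> g f0 v \<noteq> 0" for g
    proof -
      have "inv g \<in> C <#> group_center G"
        using C(2) g v by (auto simp: contragredient_action_def)
      then obtain c z where cz: "c \<in> C" "z \<in> group_center G" "inv g = c \<otimes> z"
        unfolding set_mult_def by blast
      have mem: "c \<in> carrier G" "z \<in> carrier G" using cz Cc group_center_closed by auto
      have "g = inv (z \<otimes> c)"
        using cz(3) g(1) group_center_commute[OF cz(2) mem(1)] by (metis inv_inv)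
      then have "g = inv c \<otimes> inv z" using mem by (simp add: inv_mult_group)
      then show ?thesis using cz(1) group_center_inv[OF cz(2)] unfolding set_mult_def by blast
    qed
    then show "\<exists>Q. finite Q \<and> Q \<subseteq> carrier G \<and>
      (\<forall>g\<in>carrier G. contragredient_action G V \<pi> g f0 v \<noteq> 0 \<longrightarrow>
        (\<exists>q\<in>Q. \<exists>z\<in>group_center G. contragredient_action G V \<pi> g f0 =
          contragredient_action G V \<pi> z (contragredient_action G V \<pi> q f0)))"
      using Q cover by (intro exI[of _ Q]) simp
  qed
qed

text \<open>
  The transfer for the evaluation pairing with the roles of \<open>V\<close> and its smooth dual exchanged. The
  translates of a nonzero vector separate the smooth dual because they span \<open>V\<close>.
\<close>

lemma codim_transfer_from_contragredient:
  fixes \<theta> :: "'a \<Rightarrow> 'c"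
  assumes N: "subgroup N G"
    and exh: "exhausted_by_invertible_pro_order TYPE('c) (G\<lparr>carrier := N\<rparr>) (subtopology T N)"
    and \<theta>: "smooth_character (G\<lparr>carrier := N\<rparr>) (subtopology T N) \<theta>"
    and Zc: "Z_compact G T scl V \<pi>"
    and scalar: "(\<forall>z\<in>group_center G. \<exists>c. \<forall>v\<in>V. \<pi> z v = scl c v) \<or> r \<le> 1"
    and codim: "codim_at_least fun_scale (smooth_dual G T scl V \<pi>)
      (twisted_kernel fun_scale (smooth_dual G T scl V \<pi>) (contragredient_action G V \<pi>) N
        (\<lambda>n. inverse (\<theta> n))) r"
  shows "codim_at_least scl V (twisted_kernel scl V \<pi> N \<theta>) r"
proof -
  interpret D: smooth_representation G T fun_scale "smooth_dual G T scl V \<pi>" "contragredient_action G V \<pi>"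
    by (rule smooth_representation_contragredient)
  obtain v0 where v0: "v0 \<in> V" "v0 \<noteq> 0" using nonzero V_zero by blast
  show ?thesis
  proof (rule invariant_pairing.codim_twisted_kernel_transfer[OF
        invariant_pairing_flip[OF contragredient_pairing] N _ _ v0(1) _ _ scalar codim])
    show "\<And>n. n \<in> N \<Longrightarrow> \<theta> n = inverse (\<theta> (inv n))"
      using smooth_character_inv[OF N \<theta>] by simp
    show "\<exists>M. F \<subseteq> M \<and> M \<subseteq> N \<and> subgroup M G \<and>
      (\<forall>f\<in>smooth_dual G T scl V \<pi>. \<exists>x. x \<in> fs.span ((\<lambda>m. contragredient_action G V \<pi> m f) ` M) \<and>
        (\<forall>n\<in>M. contragredient_action G V \<pi> n x = fun_scale (inverse (\<theta> n)) x) \<and>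
        f - x \<in> twisted_kernel fun_scale (smooth_dual G T scl V \<pi>) (contragredient_action G V \<pi>) M
          (\<lambda>n. inverse (\<theta> n)))" if "finite F" "F \<subseteq> N" for F
      using D.exists_average_of_exhausted[OF N exh smooth_character_inverse[OF \<theta>] that] .
    show "f = 0" if f: "f \<in> smooth_dual G T scl V \<pi>" and zero: "\<And>g. g \<in> carrier G \<Longrightarrow> f (\<pi> g v0) = 0" for f
      using coefficient_nondegenerate[OF linear_form_of_smooth_dual[OF f] v0(1) zero] v0(2) by blast
    fix f assume f: "f \<in> smooth_dual G T scl V \<pi>"
    obtain C where C: "compactin T C" "{g \<in> carrier G. f (\<pi> g v0) \<noteq> 0} \<subseteq> C <#> group_center G"
      using Zc v0(1) f unfolding Z_compact_def by blast
    obtain Q where Q: "finite Q" "Q \<subseteq> carrier G"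
      and cover: "\<And>g. g \<in> C <#> group_center G \<Longrightarrow>
        \<exists>q\<in>Q. \<exists>z\<in>group_center G. \<pi> g v0 = \<pi> z (\<pi> q v0)"
      by (rule finite_translates_mod_center[OF C(1) v0(1)]) (rule that)
    have "\<forall>g\<in>carrier G. f (\<pi> g v0) \<noteq> 0 \<longrightarrow>
        (\<exists>q\<in>Q. \<exists>z\<in>group_center G. \<pi> g v0 = \<pi> z (\<pi> q v0))"
      using C(2) cover by auto
    then show "\<exists>Q. finite Q \<and> Q \<subseteq> carrier G \<and> (\<forall>g\<in>carrier G. f (\<pi> g v0) \<noteq> 0 \<longrightarrow>
        (\<exists>q\<in>Q. \<exists>z\<in>group_center G. \<pi> g v0 = \<pi> z (\<pi> q v0)))"
      using Q by blast
  qed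
qed

end

lemma enat_eqI:
  assumes "\<And>r. enat r \<le> a \<longleftrightarrow> enat r \<le> b"
  shows "a = b"
proof (rule antisym)
  have le: "a \<le> b" if "\<And>r. enat r \<le> a \<Longrightarrow> enat r \<le> b" for a b
  proof (cases a)
    case (enat n)
    then show ?thesis using that[of n] by simp
  next
    case infinity
    then have "enat (Suc n) \<le> b" for n using that by simp
    then show ?thesis by (cases b) (auto, metis Suc_n_not_le_n)
  qed
  show "a \<le> b" "b \<le> a" using le assms by blast+
qed

theorem theorem3p3:
  fixes G :: "('g, 'm) monoid_scheme" and T :: "'g topology"
    and N :: "'g set" and \<theta> :: "'g \<Rightarrow> 'r::alg_closed_field"
    and scl :: "'r \<Rightarrow> 'v::ab_group_add \<Rightarrow> 'v"
    and V :: "'v set" and \<pi> :: "'g \<Rightarrow> 'v \<Rightarrow> 'v"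
  assumes "locally_profinite_group G T"
    and "\<exists>K. compact_open_subgroup_invertible_pro_order TYPE('r) G T K"
    and "subgroup N G" and "closedin T N"
    and "exhausted_by_invertible_pro_order TYPE('r) (G\<lparr>carrier := N\<rparr>) (subtopology T N)"
    and "smooth_character (G\<lparr>carrier := N\<rparr>) (subtopology T N) \<theta>"
    and "irreducible_smooth_representation G T scl V \<pi>"
    and "Z_compact G T scl V \<pi>"
  shows "let d = d_character scl V \<pi> N \<theta>;
             d_dual = d_character fun_scale (smooth_dual G T scl V \<pi>)
                        (contragredient_action G V \<pi>) N (\<lambda>n. inverse (\<theta> n))
         in (d_dual < \<infinity> \<longleftrightarrow> d < \<infinity>) \<and> (d < \<infinity> \<longrightarrow> d_dual = d)"
proof -
  interpret irreducible_smooth_representation G T scl V \<pi> by (rule assms(7))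
  let ?W = "smooth_dual G T scl V \<pi>" and ?\<sigma> = "contragredient_action G V \<pi>"
    and ?\<theta>' = "\<lambda>n. inverse (\<theta> n)"
  interpret D: smooth_representation G T fun_scale ?W ?\<sigma>
    by (rule smooth_representation_contragredient)
  have N: "N \<subseteq> carrier G" using subgroup.subset[OF assms(3)] .
  obtain v0 where v0: "v0 \<in> V" "v0 \<noteq> 0" using nonzero V_zero by blast
  obtain K where "compact_open_subgroup_invertible_pro_order TYPE('r) G T K" using assms(2) by blast
  then obtain f0 where "f0 \<in> ?W" "f0 v0 = 1" using exists_smooth_form[OF _ v0] by metis
  then have f0: "f0 \<in> ?W" "f0 \<noteq> 0" by auto
  let ?K = "twisted_kernel scl V \<pi> N \<theta>" and ?K' = "twisted_kernel fun_scale ?W ?\<sigma> N ?\<theta>'"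
  note forward = codim_transfer_to_contragredient[OF assms(3,5,6,8) f0]
    and backward = codim_transfer_from_contragredient[OF assms(3,5,6,8)]
  have "codim_at_least scl V ?K r \<longleftrightarrow> codim_at_least fun_scale ?W ?K' r" for r
  proof (cases "\<forall>z\<in>group_center G. \<exists>c. \<forall>v\<in>V. \<pi> z v = scl c v")
    case True
    have "\<exists>c. \<forall>f\<in>?W. ?\<sigma> z f = fun_scale c f" if z: "z \<in> group_center G" for z
    proof -
      obtain c where c: "\<forall>v\<in>V. \<pi> (inv\<^bsub>G\<^esub> z) v = scl c v" using True group_center_inv[OF z] by blast
      have "?\<sigma> z f = fun_scale c f" if f: "f \<in> ?W" for f
        using c linear_form_of_smooth_dual[OF f]
        by (auto simp: contragredient_action_def fun_scale_def form_scale form_outside)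
      then show ?thesis by blast
    qed
    then show ?thesis using forward[of r] backward[of r] True by blast
  next
    case False
    then obtain z where z: "z \<in> group_center G" and ns: "\<not> (\<exists>c. \<forall>v\<in>V. \<pi> z v = scl c v)" by blast
    have zc: "z \<in> carrier G" using group_center_closed[OF z] .
    have one: "codim_at_least scl V ?K 1 \<longleftrightarrow> codim_at_least fun_scale ?W ?K' 1"
      using forward[of 1] backward[of 1] by blast
    have V: "codim_at_least scl V ?K r" if one: "codim_at_least scl V ?K 1"
      by (rule codim_infinite_if_no_eigenvalue[where T = "\<pi> z",
            OF vs.vector_space_axioms subspace_V _ _ _ subspace_twisted_kernel _ one])
        (use zc in \<open>simp_all add: action_closed action_add action_scale
            central_minus_scalar_reflects_twisted_kernel[OF N z ns]\<close>)
    have W: "codim_at_least fun_scale ?W ?K' r" if one: "codim_at_least fun_scale ?W ?K' 1"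
      by (rule codim_infinite_if_no_eigenvalue[where T = "?\<sigma> z",
            OF vector_space_fun_scale D.subspace_V _ _ _ D.subspace_twisted_kernel _ one])
        (use zc in \<open>simp_all add: D.action_closed D.action_add D.action_scale
            central_minus_scalar_reflects_contragredient_twisted_kernel[OF N z ns]\<close>)
    show ?thesis
    proof (cases "r = 0")
      case True
      then show ?thesis by (simp add: codim_at_least_def indep_mod_def)
    next
      case False
      then have "1 \<le> r" by simp
      then show ?thesis
        using V W one vs.codim_at_least_mono[of V ?K r 1] fs.codim_at_least_mono[of ?W ?K' r 1] by blast
    qed
  qed
  then have "d_character fun_scale ?W ?\<sigma> N ?\<theta>' = d_character scl V \<pi> N \<theta>"
    by (intro enat_eqI) (simp add: le_d_character_iff[OF N] D.le_d_character_iff[OF N])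
  then show ?thesis by (simp add: Let_def)
qed

end
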